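(* Let $S$ be a finite semigroup with an anti-involution $*$, let $R$ be a field, and let $\alpha$ be a twisting from $S$ into $R$ with $\alpha(x,y)=\alpha(y^*,x^* )$ for all $x,y\in S$. Suppose that for each $\mathcal D$-class $D$ there is an idempotent $1_D\in D$ with $1_D^*=1_D$; let $G_D$ be the $\mathcal H$-class of $1_D$. Suppose that $\alpha(x,y)\neq0$ whenever $x\,\mathcal L\,1_D$ and $y\,\mathcal R\,1_D$ for some $\mathcal D$-class $D$. Suppose that for each $D$ the twisted group algebra $R^\alpha[G_D]$ is cellular with cell datum $(\Lambda_D,M_D,C,* )$, where $*$ is the linear extension of $*|_{G_D}$. For each $\mathcal L$-class $L$ in $D$ choose $u_L\in L$ with $u_L\,\mathcal R\,1_D$, and let $P_D^\alpha$ be the matrix indexed by pairs of $\mathcal L$-classes in $D$ with entries in $R^\alpha[G_D]$ given by $(P_D^\alpha)_{LK}=0$ if $u_Lu_K^*<_{\mathcal D}D$, and $(P_D^\alpha)_{LK}=\alpha(u_L,u_K^* )\,u_Lu_K^*$ if $u_Lu_K^*\in G_D$. Then $R^\alpha[S]$ is semisimple if and only if, for every $\mathcal D$-class $D$, (i) $R^\alpha[G_D]$ is semisimple and (ii) $P_D^\alpha$ is invertible (as a matrix over $R^\alpha[G_D]$).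
   Context: Green's relations ($S^1$ = $S$ with identity adjoined): $x\le_{\mathcal R}y$ iff $x\in yS^1$, $x\le_{\mathcal L}y$ iff $x\in S^1y$, $x\le_{\mathcal J}y$ iff $x\in S^1yS^1$; $\mathcal R,\mathcal L,\mathcal J$ associated equivalences; $\mathcal H=\mathcal R\cap\mathcal L$; $\mathcal D$ generated by $\mathcal R\cup\mathcal L$; for finite $S$, $\mathcal D=\mathcal J$ and $<_{\mathcal D}$ is the strict order on $\mathcal D$-classes induced by $\le_{\mathcal J}$ ($x<_{\mathcal D}D$: class of $x$ strictly below $D$). For $L,K$ in $D$, $u_Lu_K^*$ always lies either in $G_D$ or strictly below $D$. An anti-involution of $S$: $(x^* )^*=x$, $(xy)^*=y^*x^*$. A twisting satisfies $\alpha(x,y)\alpha(xy,z)=\alpha(x,yz)\alpha(y,z)$; $R^\alpha[S]$ is the algebra with basis $S$ and product $x\cdot y=\alpha(x,y)(xy)$, and $R^\alpha[G_D]$ the subalgebra spanned by $G_D$. Cellular algebra with cell datum $(\Lambda,M,C,* )$: (C1) $\Lambda$ finite poset, $\{C^\lambda_{st}:s,t\in M(\lambda)\}$ an $R$-basis; (C2) $*$ an anti-involution with $(C^\lambda_{st})^*=C^\lambda_{ts}$; (C3) for all $\lambda,s,a$ there are $r_a(s',s)\in R$ with $aC^\lambda_{st}\in\sum_{s'}r_a(s',s)C^\lambda_{s't}+A(<\lambda)$ for all $t$, $A(<\lambda)$ being the span of the $C^\mu_{uv}$ with $\mu<\lambda$. *)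

theory Defs
  imports Main
begin

section \<open>Green's relations (with S^1 = S with identity adjoined)\<close>

definition leR :: "'a::semigroup_mult \<Rightarrow> 'a \<Rightarrow> bool" where
  "leR x y \<longleftrightarrow> x = y \<or> (\<exists>s. x = y * s)"
definition leL :: "'a::semigroup_mult \<Rightarrow> 'a \<Rightarrow> bool" where
  "leL x y \<longleftrightarrow> x = y \<or> (\<exists>s. x = s * y)"
definition Rrel :: "'a::semigroup_mult \<Rightarrow> 'a \<Rightarrow> bool" where
  "Rrel x y \<longleftrightarrow> leR x y \<and> leR y x"
definition Lrel :: "'a::semigroup_mult \<Rightarrow> 'a \<Rightarrow> bool" where
  "Lrel x y \<longleftrightarrow> leL x y \<and> leL y x"
definition Hrel :: "'a::semigroup_mult \<Rightarrow> 'a \<Rightarrow> bool" where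
  "Hrel x y \<longleftrightarrow> Rrel x y \<and> Lrel x y"
text \<open>D = R o L (the join of R and L, since R and L commute).\<close>
definition Drel :: "'a::semigroup_mult \<Rightarrow> 'a \<Rightarrow> bool" where
  "Drel x y \<longleftrightarrow> (\<exists>z. Rrel x z \<and> Lrel z y)"

definition Lclass :: "'a::semigroup_mult \<Rightarrow> 'a set" where "Lclass x = {y. Lrel x y}"
definition Hclass :: "'a::semigroup_mult \<Rightarrow> 'a set" where "Hclass x = {y. Hrel x y}"
definition Dclass :: "'a::semigroup_mult \<Rightarrow> 'a set" where "Dclass x = {y. Drel x y}"

definition Dclasses :: "'a::semigroup_mult set set" where
  "Dclasses = {Dclass x | x. True}"
definition Lclasses_in :: "'a::semigroup_mult set \<Rightarrow> 'a set set" where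
  "Lclasses_in D = {Lclass x | x. x \<in> D}"

definition anti_involution :: "('a::semigroup_mult \<Rightarrow> 'a) \<Rightarrow> bool" where
  "anti_involution st \<longleftrightarrow> (\<forall>x. st (st x) = x) \<and> (\<forall>x y. st (x * y) = st y * st x)"

definition twisting :: "('a::semigroup_mult \<Rightarrow> 'a \<Rightarrow> 'r::field) \<Rightarrow> bool" where
  "twisting \<alpha> \<longleftrightarrow> (\<forall>x y z. \<alpha> x y * \<alpha> (x * y) z = \<alpha> x (y * z) * \<alpha> y z)"

text \<open>Elements of R^alpha[S] (S finite) are coefficient functions S => R;
  the product extends x . y = alpha(x,y) (xy) bilinearly.\<close>
definition tw_mult :: "('a::{finite,semigroup_mult} \<Rightarrow> 'a \<Rightarrow> 'r::field)
    \<Rightarrow> ('a \<Rightarrow> 'r) \<Rightarrow> ('a \<Rightarrow> 'r) \<Rightarrow> ('a \<Rightarrow> 'r)" where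
  "tw_mult \<alpha> f g = (\<lambda>z. \<Sum>p\<in>{p. fst p * snd p = z}. f (fst p) * g (snd p) * \<alpha> (fst p) (snd p))"

definition subalg :: "'a set \<Rightarrow> ('a \<Rightarrow> 'r::field) set" where
  "subalg T = {f. \<forall>z. z \<notin> T \<longrightarrow> f z = 0}"

text \<open>Linear extension of the anti-involution: (sum f(x) x)^* = sum f(x) x^*.\<close>
definition star_lin :: "('a \<Rightarrow> 'a) \<Rightarrow> ('a \<Rightarrow> 'r) \<Rightarrow> ('a \<Rightarrow> 'r)" where
  "star_lin st f = (\<lambda>z. f (st z))"

section \<open>Semisimplicity (finite-dimensional algebras): no nonzero nilpotent ideal\<close>

fun tw_prod :: "('a::{finite,semigroup_mult} \<Rightarrow> 'a \<Rightarrow> 'r::field) \<Rightarrow> ('a \<Rightarrow> 'r) list \<Rightarrow> ('a \<Rightarrow> 'r)" where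
  "tw_prod \<alpha> [] = (\<lambda>_. 0)"
| "tw_prod \<alpha> [f] = f"
| "tw_prod \<alpha> (f # g # hs) = tw_mult \<alpha> f (tw_prod \<alpha> (g # hs))"

definition is_ideal :: "('a::{finite,semigroup_mult} \<Rightarrow> 'a \<Rightarrow> 'r::field)
    \<Rightarrow> ('a \<Rightarrow> 'r) set \<Rightarrow> ('a \<Rightarrow> 'r) set \<Rightarrow> bool" where
  "is_ideal \<alpha> A I \<longleftrightarrow> I \<subseteq> A \<and> (\<lambda>_. 0) \<in> I
     \<and> (\<forall>f\<in>I. \<forall>g\<in>I. (\<lambda>z. f z + g z) \<in> I)
     \<and> (\<forall>c. \<forall>f\<in>I. (\<lambda>z. c * f z) \<in> I)
     \<and> (\<forall>a\<in>A. \<forall>f\<in>I. tw_mult \<alpha> a f \<in> I \<and> tw_mult \<alpha> f a \<in> I)"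

definition nilpotent_ideal :: "('a::{finite,semigroup_mult} \<Rightarrow> 'a \<Rightarrow> 'r::field)
    \<Rightarrow> ('a \<Rightarrow> 'r) set \<Rightarrow> bool" where
  "nilpotent_ideal \<alpha> I \<longleftrightarrow> (\<exists>n\<ge>1. \<forall>fs. length fs = n \<and> set fs \<subseteq> I \<longrightarrow> tw_prod \<alpha> fs = (\<lambda>_. 0))"

definition semisimple :: "('a::{finite,semigroup_mult} \<Rightarrow> 'a \<Rightarrow> 'r::field)
    \<Rightarrow> ('a \<Rightarrow> 'r) set \<Rightarrow> bool" where
  "semisimple \<alpha> A \<longleftrightarrow> (\<forall>I. is_ideal \<alpha> A I \<and> nilpotent_ideal \<alpha> I \<longrightarrow> I = {\<lambda>_. 0})"

text \<open>Cell datum (Lambda, M, C, *): Lambda a finite poset (encoded in nat with order le),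
  M lambda finite index sets, C lambda s t the cellular basis.\<close>
definition cell_index :: "nat set \<Rightarrow> (nat \<Rightarrow> nat set) \<Rightarrow> (nat \<times> nat \<times> nat) set" where
  "cell_index \<Lambda> M = {(l, s, t). l \<in> \<Lambda> \<and> s \<in> M l \<and> t \<in> M l}"

definition cell_datum :: "('a::{finite,semigroup_mult} \<Rightarrow> 'a \<Rightarrow> 'r::field) \<Rightarrow> ('a \<Rightarrow> 'a) \<Rightarrow> 'a set
    \<Rightarrow> nat set \<Rightarrow> (nat \<Rightarrow> nat \<Rightarrow> bool) \<Rightarrow> (nat \<Rightarrow> nat set) \<Rightarrow> (nat \<Rightarrow> nat \<Rightarrow> nat \<Rightarrow> ('a \<Rightarrow> 'r)) \<Rightarrow> bool" where
  "cell_datum \<alpha> st T \<Lambda> le M C \<longleftrightarrow>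
     \<comment> \<open>C1\<close>
     finite \<Lambda>
   \<and> (\<forall>l\<in>\<Lambda>. le l l)
   \<and> (\<forall>l\<in>\<Lambda>. \<forall>m\<in>\<Lambda>. le l m \<and> le m l \<longrightarrow> l = m)
   \<and> (\<forall>l\<in>\<Lambda>. \<forall>m\<in>\<Lambda>. \<forall>n\<in>\<Lambda>. le l m \<and> le m n \<longrightarrow> le l n)
   \<and> (\<forall>l\<in>\<Lambda>. finite (M l))
   \<and> (\<forall>(l, s, t)\<in>cell_index \<Lambda> M. C l s t \<in> subalg T)
   \<and> (\<forall>f\<in>subalg T. \<exists>!c. (\<forall>i. i \<notin> cell_index \<Lambda> M \<longrightarrow> c i = 0)
          \<and> f = (\<lambda>z. \<Sum>(l, s, t)\<in>cell_index \<Lambda> M. c (l, s, t) * C l s t z))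
     \<comment> \<open>C2\<close>
   \<and> (\<forall>f\<in>subalg T. star_lin st f \<in> (subalg T :: ('a \<Rightarrow> 'r) set))
   \<and> (\<forall>f\<in>subalg T. \<forall>g\<in>subalg T.
          star_lin st (tw_mult \<alpha> f g) = tw_mult \<alpha> (star_lin st g) (star_lin st f))
   \<and> (\<forall>(l, s, t)\<in>cell_index \<Lambda> M. star_lin st (C l s t) = C l t s)
     \<comment> \<open>C3\<close>
   \<and> (\<forall>l\<in>\<Lambda>. \<forall>s\<in>M l. \<forall>a\<in>subalg T. \<exists>r. \<forall>t\<in>M l. \<exists>d.
          (\<lambda>z. tw_mult \<alpha> a (C l s t) z - (\<Sum>s'\<in>M l. r s' * C l s' t z))
        = (\<lambda>z. \<Sum>(m, u, v)\<in>{(m, u, v)\<in>cell_index \<Lambda> M. le m l \<and> m \<noteq> l}. d (m, u, v) * C m u v z))"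

definition cellular :: "('a::{finite,semigroup_mult} \<Rightarrow> 'a \<Rightarrow> 'r::field) \<Rightarrow> ('a \<Rightarrow> 'a) \<Rightarrow> 'a set \<Rightarrow> bool" where
  "cellular \<alpha> st T \<longleftrightarrow> (\<exists>\<Lambda> le M C. cell_datum \<alpha> st T \<Lambda> le M C)"

definition Pmat :: "('a::{finite,semigroup_mult} \<Rightarrow> 'a \<Rightarrow> 'r::field) \<Rightarrow> ('a \<Rightarrow> 'a) \<Rightarrow> ('a set \<Rightarrow> 'a)
    \<Rightarrow> 'a set \<Rightarrow> 'a set \<Rightarrow> 'a set \<Rightarrow> ('a \<Rightarrow> 'r)" where
  "Pmat \<alpha> st u G L K =
     (if u L * st (u K) \<in> G
      then (\<lambda>z. if z = u L * st (u K) then \<alpha> (u L) (st (u K)) else 0)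
      else (\<lambda>_. 0))"

definition mat_mult :: "('a::{finite,semigroup_mult} \<Rightarrow> 'a \<Rightarrow> 'r::field) \<Rightarrow> 'i set
    \<Rightarrow> ('i \<Rightarrow> 'i \<Rightarrow> ('a \<Rightarrow> 'r)) \<Rightarrow> ('i \<Rightarrow> 'i \<Rightarrow> ('a \<Rightarrow> 'r)) \<Rightarrow> 'i \<Rightarrow> 'i \<Rightarrow> ('a \<Rightarrow> 'r)" where
  "mat_mult \<alpha> I P Q i j = (\<lambda>z. \<Sum>k\<in>I. tw_mult \<alpha> (P i k) (Q k j) z)"

definition mat_invertible :: "('a::{finite,semigroup_mult} \<Rightarrow> 'a \<Rightarrow> 'r::field) \<Rightarrow> ('a \<Rightarrow> 'r) set
    \<Rightarrow> 'i set \<Rightarrow> ('i \<Rightarrow> 'i \<Rightarrow> ('a \<Rightarrow> 'r)) \<Rightarrow> bool" where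
  "mat_invertible \<alpha> A I P \<longleftrightarrow>
     (\<exists>one\<in>A. (\<forall>f\<in>A. tw_mult \<alpha> one f = f \<and> tw_mult \<alpha> f one = f)
       \<and> (\<exists>Q. (\<forall>i\<in>I. \<forall>j\<in>I. Q i j \<in> A)
            \<and> (\<forall>i\<in>I. \<forall>j\<in>I. mat_mult \<alpha> I P Q i j = (if i = j then one else (\<lambda>_. 0)))
            \<and> (\<forall>i\<in>I. \<forall>j\<in>I. mat_mult \<alpha> I Q P i j = (if i = j then one else (\<lambda>_. 0)))))"

end

(*
  For a finite-dimensional algebra A, having no nonzero nilpotent ideal is equivalent to:
  f A f = 0 implies f = 0.  In a semiprime finite-dimensional algebra every two-sided ideal has
  an identity element (via idempotents of minimal left ideals).

  Fix a D-class D with idempotent e = 1_D and let B be the twisted group algebra of G_D.  Modulo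
  the span of the elements strictly below D, every element of the span of D is uniquely a sum of
  products u_K^* c_KM u_M with c_KM in B, and u_L u_K^* acts as the entry P_LK.
  If A is semiprime, let E and E' be the identities of the ideals spanned by the elements below or
  in D and strictly below D.  The coordinates of E form an inverse of P, and for b in B with
  b B b = 0 the element f = b - E' b satisfies f A f = 0, whence b = 0.
  Conversely, let f A f = 0 with f nonzero, and let D be maximal among the classes meeting the
  support of f, c the coordinate matrix of f on D.  The entries of P c P are congruent to the
  elements u_L f u_N^*, so x B x = 0 for each entry x; thus P c P = 0 and c = 0.
*)
theory Submission
  imports Defs "HOL-Library.Function_Algebras" "HOL.Vector_Spaces"
begin

section \<open>Finite-dimensional semiprime algebras\<close>

locale fd_algebra = finite_dimensional_vector_space scale Basis
  for scale :: "'r::field \<Rightarrow> 'v::ab_group_add \<Rightarrow> 'v" and Basis +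
  fixes mult :: "'v \<Rightarrow> 'v \<Rightarrow> 'v" (infixl "\<star>" 70)
  assumes assoc: "(x \<star> y) \<star> z = x \<star> (y \<star> z)"
    and add_left: "(x + y) \<star> z = x \<star> z + y \<star> z"
    and add_right: "x \<star> (y + z) = x \<star> y + x \<star> z"
    and scale_left: "scale c x \<star> y = scale c (x \<star> y)"
    and scale_right: "x \<star> scale c y = scale c (x \<star> y)"
begin

lemma zero_left [simp]: "0 \<star> x = 0"
  by (metis add_left add_cancel_left_left add_0)

lemma zero_right [simp]: "x \<star> 0 = 0"
  by (metis add_right add_cancel_left_left add_0)

lemma diff_left: "(x - y) \<star> z = x \<star> z - y \<star> z"
  by (metis add_left add_diff_cancel diff_add_cancel)

lemma diff_right: "x \<star> (y - z) = x \<star> y - x \<star> z"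
  by (metis add_right add_diff_cancel diff_add_cancel)

lemma sum_left: "(\<Sum>i\<in>I. f i) \<star> x = (\<Sum>i\<in>I. f i \<star> x)"
  by (induction I rule: infinite_finite_induct) (auto simp: add_left)

lemma sum_right: "x \<star> (\<Sum>i\<in>I. f i) = (\<Sum>i\<in>I. x \<star> f i)"
  by (induction I rule: infinite_finite_induct) (auto simp: add_right)

text \<open>An elementwise replacement for the absence of nonzero nilpotent ideals. The parameter
  \<open>A\<close> lets it apply both to the whole algebra and to the twisted group algebra of
  \<open>G\<close>.\<close>

definition semiprime_on :: "'v set \<Rightarrow> bool" where
  "semiprime_on A \<longleftrightarrow> (\<forall>f\<in>A. (\<forall>a\<in>A. f \<star> (a \<star> f) = 0) \<longrightarrow> f = 0)"

definition left_ideal :: "'v set \<Rightarrow> bool" where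
  "left_ideal L \<longleftrightarrow> subspace L \<and> (\<forall>a. \<forall>x\<in>L. a \<star> x \<in> L)"

text \<open>A member of least dimension is minimal, because a subspace contained in another of no
  larger dimension equals it. The family \<open>P\<close> is left free: it is used for nonzero left
  ideals inside a given one and for annihilators of idempotents.\<close>

lemma left_ideal_minimal:
  assumes "P L" "\<And>K. P K \<Longrightarrow> left_ideal K"
  shows "\<exists>K. P K \<and> (\<forall>K'. P K' \<longrightarrow> K' \<subseteq> K \<longrightarrow> K' = K)"
proof -
  obtain K where K: "P K" "\<And>K'. P K' \<Longrightarrow> dim K \<le> dim K'"
    using ex_has_least_nat[of P L dim] assms(1) by blast
  have "K' = K" if "P K'" "K' \<subseteq> K" for K'
    using subspace_dim_equal[of K' K] K that assms(2) unfolding left_ideal_def by blast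
  with K(1) show ?thesis by blast
qed

lemma left_ideal_annihilator:
  assumes "left_ideal L"
  shows "left_ideal {y \<in> L. y \<star> x = 0}"
  using assms unfolding left_ideal_def subspace_def
  by (auto simp: add_left scale_left assoc)

text \<open>Brauer's lemma: if \<open>L\<close> is minimal and \<open>L x \<noteq> 0\<close> with \<open>x \<in> L\<close>, then \<open>L x = L\<close>, and any
  \<open>e \<in> L\<close> with \<open>e x = x\<close> is idempotent because \<open>e\<^sup>2 - e\<close> annihilates \<open>x\<close>.\<close>

lemma left_ideal_has_idempotent:
  assumes sp: "semiprime_on UNIV" and L: "left_ideal L" "L \<noteq> {0}"
  obtains e where "e \<in> L" "e \<star> e = e" "e \<noteq> 0"
proof -
  let ?P = "\<lambda>K. left_ideal K \<and> K \<noteq> {0} \<and> K \<subseteq> L"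
  have "\<exists>K. ?P K \<and> (\<forall>K'. ?P K' \<longrightarrow> K' \<subseteq> K \<longrightarrow> K' = K)"
    by (rule left_ideal_minimal[of ?P L]) (use L in auto)
  then obtain K where min: "?P K \<and> (\<forall>K'. ?P K' \<longrightarrow> K' \<subseteq> K \<longrightarrow> K' = K)" ..
  then have K: "left_ideal K" "K \<noteq> {0}" "K \<subseteq> L" by auto
  have Kmin: "K' = K" if "left_ideal K'" "K' \<noteq> {0}" "K' \<subseteq> K" for K'
    using min that K(3) by (meson order_trans)
  have K0: "0 \<in> K" using K(1) by (auto simp: left_ideal_def subspace_def)
  then obtain y where y: "y \<in> K" "y \<noteq> 0" using K(2) by blast
  \<comment> \<open>Since \<open>y\<close> is nonzero, semiprimeness gives
    \<open>x = a \<star> y\<close> in \<open>K\<close> with \<open>K \<star> x\<close> nonzero, the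
    starting point of Brauer's argument.\<close>
  then obtain a where a: "y \<star> (a \<star> y) \<noteq> 0" using sp unfolding semiprime_on_def by blast
  define x where "x = a \<star> y"
  have x: "x \<in> K" "y \<star> x \<noteq> 0" using K(1) y a by (auto simp: left_ideal_def x_def)
  have "left_ideal ((\<lambda>z. z \<star> x) ` K)"
    unfolding left_ideal_def subspace_def
  proof (intro conjI ballI allI)
    show "0 \<in> (\<lambda>z. z \<star> x) ` K" using K0 by (auto intro!: image_eqI[where x=0])
  next
    fix v w assume "v \<in> (\<lambda>z. z \<star> x) ` K" "w \<in> (\<lambda>z. z \<star> x) ` K"
    then obtain v' w' where "v' \<in> K" "w' \<in> K" "v = v' \<star> x" "w = w' \<star> x" by blast
    then show "v + w \<in> (\<lambda>z. z \<star> x) ` K"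
      using K(1) by (auto intro!: image_eqI[where x="v' + w'"] simp: add_left left_ideal_def subspace_def)
  next
    fix c v assume "v \<in> (\<lambda>z. z \<star> x) ` K"
    then obtain v' where "v' \<in> K" "v = v' \<star> x" by blast
    then show "scale c v \<in> (\<lambda>z. z \<star> x) ` K"
      using K(1) by (auto intro!: image_eqI[where x="scale c v'"] simp: scale_left left_ideal_def subspace_def)
  next
    fix b v assume "v \<in> (\<lambda>z. z \<star> x) ` K"
    then obtain v' where "v' \<in> K" "v = v' \<star> x" by blast
    then show "b \<star> v \<in> (\<lambda>z. z \<star> x) ` K"
      using K(1) by (auto intro!: image_eqI[where x="b \<star> v'"] simp: assoc left_ideal_def)
  qed
  moreover have "(\<lambda>z. z \<star> x) ` K \<noteq> {0}" using x y by blast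
  moreover have "(\<lambda>z. z \<star> x) ` K \<subseteq> K" using K(1) x(1) by (auto simp: left_ideal_def)
  ultimately have "(\<lambda>z. z \<star> x) ` K = K" using Kmin by blast
  then have "x \<in> (\<lambda>z. z \<star> x) ` K" using x(1) by (rule ssubst)
  then obtain e where e: "e \<in> K" "e \<star> x = x" unfolding image_iff by metis
  \<comment> \<open>By minimality the annihilator of \<open>x\<close> in \<open>K\<close> is zero or
    all of \<open>K\<close>, and \<open>y\<close> excludes the latter.\<close>
  have "{z \<in> K. z \<star> x = 0} = {0}"
  proof (rule ccontr)
    assume "{z \<in> K. z \<star> x = 0} \<noteq> {0}"
    then have "{z \<in> K. z \<star> x = 0} = K"
      by (rule Kmin[OF left_ideal_annihilator[OF K(1)]]) auto
    then show False using x(2) y(1) by blast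
  qed
  moreover have "e \<star> e - e \<in> {z \<in> K. z \<star> x = 0}"
    using K(1) e by (auto simp: left_ideal_def subspace_diff diff_left assoc)
  ultimately have "e \<star> e = e" by auto
  moreover have "e \<noteq> 0" using e x by force
  ultimately show thesis using that e K(3) by blast
qed

text \<open>Choose an idempotent \<open>e\<close> in \<open>L\<close> whose left annihilator in
  \<open>L\<close> is minimal. A nonzero annihilator would contain an idempotent with which
  \<open>e\<close> could be enlarged, so it vanishes; as it contains every
  \<open>x - x \<star> e\<close>, the element \<open>e\<close> is a right identity.\<close>

lemma left_ideal_right_identity:
  assumes sp: "semiprime_on UNIV" and L: "left_ideal L"
  obtains e where "e \<in> L" "\<And>x. x \<in> L \<Longrightarrow> x \<star> e = x"
proof -
  let ?ann = "\<lambda>e. {y \<in> L. y \<star> e = 0}"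
  let ?P = "\<lambda>K. \<exists>e\<in>L. e \<star> e = e \<and> K = ?ann e"
  have L0: "0 \<in> L" using L by (auto simp: left_ideal_def subspace_def)
  have ann: "left_ideal (?ann e)" for e by (rule left_ideal_annihilator[OF L])
  \<comment> \<open>The zero idempotent, whose annihilator is all of \<open>L\<close>, shows that
    the family is nonempty.\<close>
  have "?P (?ann 0)" using L0 by (intro bexI[of _ 0]) auto
  moreover have "left_ideal K" if "?P K" for K using that ann by blast
  ultimately have "\<exists>K. ?P K \<and> (\<forall>K'. ?P K' \<longrightarrow> K' \<subseteq> K \<longrightarrow> K' = K)"
    by (rule left_ideal_minimal[of ?P "?ann 0"])
  then obtain K where min: "?P K \<and> (\<forall>K'. ?P K' \<longrightarrow> K' \<subseteq> K \<longrightarrow> K' = K)" ..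
  then obtain e where e: "e \<in> L" "e \<star> e = e" and K: "K = ?ann e" by blast
  have "K = {0}"
  proof (rule ccontr)
    assume "K \<noteq> {0}"
    then obtain f where f: "f \<in> K" "f \<star> f = f" "f \<noteq> 0"
      using left_ideal_has_idempotent[OF sp] ann K by blast
    \<comment> \<open>From \<open>f \<star> e = 0\<close> it follows that \<open>g\<close> fixes
      \<open>e\<close> and \<open>f\<close> from the left, hence is idempotent and annihilated by no
      more than \<open>e\<close> is. But \<open>f\<close> annihilates \<open>e\<close> and not
      \<open>g\<close>, so the annihilator shrinks strictly.\<close>
    define g where "g = e + f - e \<star> f"
    have fL: "f \<in> L" "f \<star> e = 0" using f K by auto
    have gL: "g \<in> L" using L e fL unfolding g_def
      by (auto simp: left_ideal_def intro!: subspace_add subspace_diff)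
    have ge: "g \<star> e = e" by (simp add: g_def add_left diff_left assoc fL e)
    have gf: "g \<star> f = f" by (simp add: g_def add_left diff_left assoc f)
    have gg: "g \<star> g = g"
      by (subst (2) g_def) (simp add: add_right diff_right ge gf assoc[symmetric], simp add: g_def)
    have "?ann g \<subseteq> K"
    proof
      fix y assume "y \<in> ?ann g"
      then have y: "y \<in> L" "y \<star> g = 0" by auto
      have "y \<star> e = (y \<star> g) \<star> e" by (simp only: assoc ge)
      then show "y \<in> K" using y K by simp
    qed
    moreover have "?P (?ann g)" using gL gg by blast
    ultimately have "?ann g = K" using min by simp
    then have "f \<star> g = 0" using f by blast
    moreover have "f \<star> g = f"
      by (simp add: g_def add_right diff_right fL f assoc[symmetric])
    ultimately show False using f by simp
  qed
  have "x \<star> e = x" if "x \<in> L" for x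
  proof -
    have "x - x \<star> e \<in> K" using L e that unfolding K
      by (auto simp: left_ideal_def diff_left assoc intro!: subspace_diff)
    then show ?thesis using \<open>K = {0}\<close> by auto
  qed
  then show thesis using that e by blast
qed

text \<open>Start with a right identity \<open>e\<close> of \<open>J\<close>. For
  \<open>y = x - e \<star> x\<close> one has \<open>e \<star> y = 0\<close>, and
  \<open>y \<star> a\<close> lies in \<open>J\<close>, so \<open>e\<close> can be inserted after it:
  \<open>y \<star> a \<star> y\<close> becomes \<open>y \<star> a \<star> e \<star> y = 0\<close>.
  Semiprimeness then gives \<open>y = 0\<close>.\<close>

lemma two_sided_ideal_identity:
  assumes sp: "semiprime_on UNIV" and J: "left_ideal J" "\<And>a x. x \<in> J \<Longrightarrow> x \<star> a \<in> J"
  obtains e where "e \<in> J" "\<And>x. x \<in> J \<Longrightarrow> x \<star> e = x" "\<And>x. x \<in> J \<Longrightarrow> e \<star> x = x"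
proof -
  obtain e where e: "e \<in> J" "\<And>x. x \<in> J \<Longrightarrow> x \<star> e = x"
    using left_ideal_right_identity[OF sp J(1)] by blast
  have "e \<star> x = x" if x: "x \<in> J" for x
  proof -
    let ?y = "x - e \<star> x"
    have "?y \<in> J" using J x e by (auto simp: left_ideal_def subspace_diff)
    have "?y \<star> (a \<star> ?y) = 0" for a
    proof -
      have ya: "?y \<star> a \<in> J" using J(2) \<open>?y \<in> J\<close> by blast
      have "(?y \<star> a) \<star> ?y = (?y \<star> a \<star> e) \<star> ?y" using e(2)[OF ya] by simp
      also have "\<dots> = 0" using e by (simp add: assoc diff_right) (simp add: assoc[symmetric] e)
      finally show ?thesis by (simp add: assoc)
    qed
    then have "?y = 0" using sp unfolding semiprime_on_def by blast
    then show ?thesis by simp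
  qed
  with e that show thesis by blast
qed

end

section \<open>Green's relations in a finite semigroup\<close>

lemma leR_refl [simp]: "leR x x" and leL_refl [simp]: "leL x x"
  by (auto simp: leR_def leL_def)

lemma leR_mult [simp]: "leR (x * s) x" and leL_mult [simp]: "leL (s * x) x"
  by (auto simp: leR_def leL_def)

lemma leR_trans: "leR x y \<Longrightarrow> leR y z \<Longrightarrow> leR x z"
  unfolding leR_def by (metis mult.assoc)

lemma leL_trans: "leL x y \<Longrightarrow> leL y z \<Longrightarrow> leL x z"
  unfolding leL_def by (metis mult.assoc)

lemma leR_mult_left: "leR x y \<Longrightarrow> leR (s * x) (s * y)"
  unfolding leR_def by (metis mult.assoc)

lemma leL_leR_commute: "(\<exists>z. leL x z \<and> leR z y) \<longleftrightarrow> (\<exists>z. leR x z \<and> leL z y)"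
  unfolding leL_def leR_def by (metis mult.assoc)

text \<open>Composing the one-sided preorders expresses membership in the two-sided principal ideal
  without adjoining an identity: each of the two factors may be absent.\<close>

definition leJ :: "'a::semigroup_mult \<Rightarrow> 'a \<Rightarrow> bool" where
  "leJ x y \<longleftrightarrow> (\<exists>z. leL x z \<and> leR z y)"

lemma leJ_altdef: "leJ x y \<longleftrightarrow> (\<exists>z. leR x z \<and> leL z y)"
  unfolding leJ_def by (rule leL_leR_commute)

lemma leR_imp_leJ: "leR x y \<Longrightarrow> leJ x y" and leL_imp_leJ: "leL x y \<Longrightarrow> leJ x y"
  unfolding leJ_def using leL_refl leR_refl by blast+

lemma leJ_refl [simp]: "leJ x x"
  by (simp add: leR_imp_leJ)

lemma leJ_trans:
  assumes "leJ x y" "leJ y z"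
  shows "leJ x z"
proof -
  obtain v w where "leL x v" "leR v y" "leL y w" "leR w z"
    using assms unfolding leJ_def by blast
  moreover from this obtain t where "leL v t" "leR t w" using leL_leR_commute by blast
  ultimately show ?thesis unfolding leJ_def using leL_trans leR_trans by blast
qed

section \<open>Stability of finite semigroups\<close>

lemma mult_funpow_right: "s * ((\<lambda>v. v * w) ^^ n) x = ((\<lambda>v. v * w) ^^ n) (s * x)"
  for x :: "'a::semigroup_mult"
  by (induction n) (simp_all add: mult.assoc[symmetric])

lemma leR_funpow: "leR (((\<lambda>v. v * w) ^^ n) x) x"
  by (induction n) (auto intro: leR_trans[OF leR_mult])

text \<open>Iterating \<open>x = s x w\<close> gives \<open>x = s\<^sup>i x w\<^sup>i\<close>; by finiteness \<open>x w\<^sup>i = x w\<^bsup>i+d\<^esup>\<close> for some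
  \<open>d > 0\<close>, whence \<open>x = x w\<^sup>d\<close>.\<close>

lemma leR_cancel:
  fixes x :: "'a::{finite,semigroup_mult}"
  assumes x: "x = s * x * w"
  shows "leR x (x * w)"
proof -
  define r where "r = (\<lambda>v::'a. v * w)"
  have sr: "s * (r ^^ n) y = (r ^^ n) (s * y)" for n y
    unfolding r_def by (rule mult_funpow_right)
  have srs: "((\<lambda>v. s * v) ^^ m) ((r ^^ n) y) = (r ^^ n) (((\<lambda>v. s * v) ^^ m) y)" for m n y
    by (induction m) (simp_all add: sr)
  have inv: "((\<lambda>v. s * v) ^^ n) ((r ^^ n) x) = x" for n
  proof (induction n)
    case (Suc n)
    have "((\<lambda>v. s * v) ^^ Suc n) ((r ^^ Suc n) x) = ((\<lambda>v. s * v) ^^ n) (s * (r ^^ n) (r x))"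
      by (simp add: funpow_swap1)
    also have "s * (r ^^ n) (r x) = (r ^^ n) x"
      using x by (simp add: sr) (simp add: r_def mult.assoc)
    finally show ?case using Suc by simp
  qed simp
  have "\<not> inj (\<lambda>n. (r ^^ n) x)"
    using finite_imageD[OF finite, of "\<lambda>n. (r ^^ n) x" UNIV] by auto
  then obtain i j where ij: "i < j" "(r ^^ i) x = (r ^^ j) x"
    unfolding inj_def by (metis nat_neq_iff)
  then obtain d where d: "j = Suc d + i" by (metis add.commute less_imp_Suc_add add_Suc_right)
  have "x = ((\<lambda>v. s * v) ^^ i) ((r ^^ j) x)" using inv[of i] ij by simp
  also have "\<dots> = (r ^^ Suc d) (((\<lambda>v. s * v) ^^ i) ((r ^^ i) x))"
    unfolding d funpow_add comp_apply by (rule srs)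
  also have "\<dots> = (r ^^ d) (x * w)" unfolding inv by (simp add: funpow_swap1) (simp add: r_def)
  finally have "leR x (x * w) = leR ((r ^^ d) (x * w)) (x * w)" by simp
  then show ?thesis using leR_funpow[of d w "x * w"] unfolding r_def by blast
qed

text \<open>Writing \<open>y = x * w\<close> and \<open>x = s * y * t\<close> gives
  \<open>x = s * x * (w * t)\<close>, so \<open>x\<close> lies below \<open>x * w * t\<close> and
  hence below \<open>y\<close>. The case distinctions treat absent factors.\<close>

lemma leR_stable:
  fixes x y :: "'a::{finite,semigroup_mult}"
  assumes "leR y x" "leJ x y"
  shows "leR x y"
proof (cases "y = x")
  case False
  then obtain w where w: "y = x * w" using assms by (auto simp: leR_def)
  obtain z where z: "leL x z" "leR z y" using assms(2) by (auto simp: leJ_def)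
  show ?thesis
  proof (cases "x = z")
    case False
    then obtain s where s: "x = s * z" using z by (auto simp: leL_def)
    show ?thesis
    proof (cases "z = y")
      case True
      then have "x = s * x * w" using s w by (simp add: mult.assoc)
      then show ?thesis using leR_cancel w by blast
    next
      case False
      then obtain t where "z = y * t" using z by (auto simp: leR_def)
      then have "x = s * x * (w * t)" using s w by (simp add: mult.assoc)
      then have "leR x (x * (w * t))" by (rule leR_cancel)
      then show ?thesis using leR_trans w leR_mult[of "x * w" t] by (simp add: mult.assoc)
    qed
  qed (use z in simp)
qed simp

lemma mult_funpow_left: "((\<lambda>v. s * v) ^^ n) x * w = ((\<lambda>v. s * v) ^^ n) (x * w)"
  for x :: "'a::semigroup_mult"
  by (induction n) (simp_all add: mult.assoc)

lemma leL_funpow: "leL (((\<lambda>v. s * v) ^^ n) x) x"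
  by (induction n) (auto intro: leL_trans[OF leL_mult])

text \<open>Mirror image of \<open>leR_cancel\<close>: two powers of left multiplication by
  \<open>s\<close> agree on \<open>x\<close>, and cancelling the common part gives \<open>x\<close>
  as a positive power of \<open>s\<close> applied to \<open>x\<close>.\<close>

lemma leL_cancel:
  fixes x :: "'a::{finite,semigroup_mult}"
  assumes x: "x = s * x * w"
  shows "leL x (s * x)"
proof -
  define r where "r = (\<lambda>v::'a. s * v)"
  have sr: "(r ^^ n) y * w = (r ^^ n) (y * w)" for n y
    unfolding r_def by (rule mult_funpow_left)
  have srs: "((\<lambda>v. v * w) ^^ m) ((r ^^ n) y) = (r ^^ n) (((\<lambda>v. v * w) ^^ m) y)" for m n y
    by (induction m) (simp_all add: sr)
  have inv: "((\<lambda>v. v * w) ^^ n) ((r ^^ n) x) = x" for n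
  proof (induction n)
    case (Suc n)
    have "((\<lambda>v. v * w) ^^ Suc n) ((r ^^ Suc n) x) = ((\<lambda>v. v * w) ^^ n) ((r ^^ n) (r x) * w)"
      using funpow_swap1[of "\<lambda>v. v * w" n "(r ^^ n) (r x)"] funpow_swap1[of r n x] by simp
    also have "(r ^^ n) (r x) * w = (r ^^ n) x"
      using x by (simp add: sr) (simp add: r_def mult.assoc)
    finally show ?case using Suc by simp
  qed simp
  have "\<not> inj (\<lambda>n. (r ^^ n) x)"
    using finite_imageD[OF finite, of "\<lambda>n. (r ^^ n) x" UNIV] by auto
  then obtain i j where ij: "i < j" "(r ^^ i) x = (r ^^ j) x"
    unfolding inj_def by (metis nat_neq_iff)
  then obtain d where d: "j = Suc d + i" by (metis add.commute less_imp_Suc_add add_Suc_right)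
  have "x = ((\<lambda>v. v * w) ^^ i) ((r ^^ j) x)" using inv[of i] ij by simp
  also have "\<dots> = (r ^^ Suc d) (((\<lambda>v. v * w) ^^ i) ((r ^^ i) x))"
    unfolding d funpow_add comp_apply by (rule srs)
  also have "\<dots> = (r ^^ d) (s * x)" unfolding inv by (simp add: funpow_swap1) (simp add: r_def)
  finally have "leL x (s * x) = leL ((r ^^ d) (s * x)) (s * x)" by simp
  then show ?thesis using leL_funpow[of d s "s * x"] unfolding r_def by blast
qed

lemma leL_stable:
  fixes x y :: "'a::{finite,semigroup_mult}"
  assumes "leL y x" "leJ x y"
  shows "leL x y"
proof (cases "y = x")
  case False
  then obtain w where w: "y = w * x" using assms by (auto simp: leL_def)
  obtain z where z: "leR x z" "leL z y" using assms(2) by (auto simp: leJ_altdef)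
  show ?thesis
  proof (cases "x = z")
    case False
    then obtain s where s: "x = z * s" using z by (auto simp: leR_def)
    show ?thesis
    proof (cases "z = y")
      case True
      then have "x = w * x * s" using s w by (simp add: mult.assoc)
      then show ?thesis using leL_cancel w by blast
    next
      case False
      then obtain t where "z = t * y" using z by (auto simp: leL_def)
      then have "x = (t * w) * x * s" using s w by (simp add: mult.assoc)
      then have "leL x ((t * w) * x)" by (rule leL_cancel)
      then show ?thesis using leL_trans[OF _ leL_mult[of t "w * x"]] w by (simp add: mult.assoc)
    qed
  qed (use z in simp)
qed simp

text \<open>Given an element between \<open>x\<close> and \<open>y\<close> for the one-sided
  preorders, stability reverses both comparisons. Symmetry and transitivity of the composite
  relation \<open>Drel\<close> then come for free.\<close>

lemma Drel_iff_leJ: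
  fixes x y :: "'a::{finite,semigroup_mult}"
  shows "Drel x y \<longleftrightarrow> leJ x y \<and> leJ y x"
proof
  assume "Drel x y"
  then show "leJ x y \<and> leJ y x"
    unfolding Drel_def Rrel_def Lrel_def using leR_imp_leJ leL_imp_leJ leJ_trans by blast
next
  assume xy: "leJ x y \<and> leJ y x"
  then obtain z where z: "leR x z" "leL z y" by (auto simp: leJ_altdef)
  have "leR z x"
    using z xy by (meson leR_stable leL_imp_leJ leJ_trans)
  moreover have "leL y z"
    using z xy by (meson leL_stable leR_imp_leJ leJ_trans)
  ultimately show "Drel x y" unfolding Drel_def Rrel_def Lrel_def using z by blast
qed

lemma Drel_sym: "Drel x y \<Longrightarrow> Drel y x"
  and Drel_trans: "Drel x y \<Longrightarrow> Drel y z \<Longrightarrow> Drel x z"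
  for x y z :: "'a::{finite,semigroup_mult}"
  unfolding Drel_iff_leJ using leJ_trans by blast+

lemma Rrel_sym: "Rrel x y \<Longrightarrow> Rrel y x" and Lrel_sym: "Lrel x y \<Longrightarrow> Lrel y x"
  unfolding Rrel_def Lrel_def by auto

lemma Rrel_trans: "Rrel x y \<Longrightarrow> Rrel y z \<Longrightarrow> Rrel x z"
  unfolding Rrel_def using leR_trans by blast

lemma Lrel_trans: "Lrel x y \<Longrightarrow> Lrel y z \<Longrightarrow> Lrel x z"
  unfolding Lrel_def using leL_trans by blast

lemma Lclass_eq: "Lrel x y \<Longrightarrow> Lclass x = Lclass y"
  unfolding Lclass_def using Lrel_sym Lrel_trans by blast

lemma Dclass_eq: "Drel x y \<Longrightarrow> Dclass x = Dclass y" for x y :: "'a::{finite,semigroup_mult}"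
  unfolding Dclass_def using Drel_sym Drel_trans by blast

section \<open>Green's relations to an idempotent, and the effect of the anti-involution\<close>

lemma leR_idempotent_iff: "e * e = e \<Longrightarrow> leR x e \<longleftrightarrow> e * x = x"
  unfolding leR_def by (metis mult.assoc)

lemma leL_idempotent_iff: "e * e = e \<Longrightarrow> leL x e \<longleftrightarrow> x * e = x"
  unfolding leL_def by (metis mult.assoc)

lemma Rrel_idempotent_iff: "e * e = e \<Longrightarrow> Rrel x e \<longleftrightarrow> e * x = x \<and> (\<exists>s. x * s = e)"
  unfolding Rrel_def by (simp add: leR_idempotent_iff) (metis leR_def)

lemma Lrel_idempotent_iff: "e * e = e \<Longrightarrow> Lrel x e \<longleftrightarrow> x * e = x \<and> (\<exists>s. s * x = e)"
  unfolding Lrel_def by (simp add: leL_idempotent_iff) (metis leL_def)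

lemma anti_involution_leR: "anti_involution st \<Longrightarrow> leR (st x) (st y) \<longleftrightarrow> leL x y"
  unfolding anti_involution_def leR_def leL_def by metis

lemma anti_involution_Rrel: "anti_involution st \<Longrightarrow> Rrel (st x) (st y) \<longleftrightarrow> Lrel x y"
  unfolding Rrel_def Lrel_def by (simp add: anti_involution_leR)

lemma anti_involution_Lrel: "anti_involution st \<Longrightarrow> Lrel (st x) (st y) \<longleftrightarrow> Rrel x y"
  using anti_involution_Rrel[of st "st x" "st y"] by (simp add: anti_involution_def)

section \<open>Coordinates on a regular \<open>\<D>\<close>-class\<close>

locale pointed_Dclass =
  fixes st :: "'a::{finite,semigroup_mult} \<Rightarrow> 'a" and e :: 'a and u :: "'a set \<Rightarrow> 'a"
  assumes inv: "anti_involution st"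
    and ee: "e * e = e"
    and st_e: "st e = e"
    and u_in: "L \<in> Lclasses_in (Dclass e) \<Longrightarrow> u L \<in> L"
    and u_R: "L \<in> Lclasses_in (Dclass e) \<Longrightarrow> Rrel (u L) e"
begin

abbreviation "D \<equiv> Dclass e"
abbreviation "G \<equiv> Hclass e"
abbreviation "I \<equiv> Lclasses_in D"
abbreviation "Rc \<equiv> {y. Rrel y e}"
abbreviation "below \<equiv> {x. leJ x e \<and> \<not> leJ e x}"

lemma D_iff: "x \<in> D \<longleftrightarrow> leJ x e \<and> leJ e x"
  unfolding Dclass_def Drel_iff_leJ by auto

lemma G_iff: "x \<in> G \<longleftrightarrow> Rrel x e \<and> Lrel x e"
  unfolding Hclass_def Hrel_def using Rrel_sym Lrel_sym by blast

lemma Rc_subset_D: "Rc \<subseteq> D" and Lc_subset_D: "Lrel x e \<Longrightarrow> x \<in> D"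
  by (auto simp: D_iff Rrel_def Lrel_def intro: leR_imp_leJ leL_imp_leJ)

lemma e_in_G: "e \<in> G"
  unfolding G_iff Rrel_def Lrel_def by simp

lemma below_mult: "x \<in> below \<Longrightarrow> s * x \<in> below" "x \<in> below \<Longrightarrow> x * s \<in> below"
  using leJ_trans[OF leL_imp_leJ[OF leL_mult[of s x]]] leJ_trans[OF leR_imp_leJ[OF leR_mult[of x s]]]
    leJ_trans[OF _ leL_imp_leJ[OF leL_mult[of s x]]] leJ_trans[OF _ leR_imp_leJ[OF leR_mult[of x s]]]
  by auto

text \<open>An element of the corner of \<open>e\<close> is below \<open>e\<close> in both one-sided
  preorders. If it is not strictly below in the two-sided one, stability puts it in both one-sided
  classes of \<open>e\<close>.\<close>

lemma corner_cases:
  assumes "e * x = x" "x * e = x"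
  shows "x \<in> G \<or> x \<in> below"
proof (cases "leJ e x")
  case True
  have "leR x e" "leL x e" using assms ee leR_idempotent_iff leL_idempotent_iff by blast+
  then show ?thesis using True leR_stable leL_stable
    unfolding G_iff Rrel_def Lrel_def by blast
next
  case False
  have "leJ x e" using assms(2) leL_mult[of x e] leL_imp_leJ by simp
  then show ?thesis using False by simp
qed

text \<open>This is the dichotomy behind the sandwich matrix: such a product lies in the corner of
  \<open>e\<close>.\<close>

lemma Rc_mult_Lc: "Rrel v e \<Longrightarrow> Lrel w e \<Longrightarrow> v * w \<in> G \<or> v * w \<in> below"
proof (rule corner_cases)
  assume v: "Rrel v e" and w: "Lrel w e"
  show "e * (v * w) = v * w"
    using v by (simp add: Rrel_idempotent_iff[OF ee] mult.assoc[symmetric])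
  show "(v * w) * e = v * w"
    using w by (simp add: Lrel_idempotent_iff[OF ee] mult.assoc)
qed

lemma G_mult_Rc:
  assumes g: "g \<in> G" and y: "Rrel y e"
  shows "Rrel (g * y) e"
proof -
  obtain s where s: "e * g = g" "g * e = g" "g * s = e"
    using g by (auto simp: G_iff Rrel_idempotent_iff[OF ee] Lrel_idempotent_iff[OF ee])
  obtain t where t: "y * t = e" using y Rrel_idempotent_iff[OF ee] by blast
  have "e * (g * y) = g * y" using s(1) by (simp add: mult.assoc[symmetric])
  moreover have "g * y * (t * s) = g * (y * t) * s" by (simp add: mult.assoc)
  then have "g * y * (t * s) = e" by (simp add: t s)
  ultimately show ?thesis using Rrel_idempotent_iff[OF ee] by blast
qed

lemma Lc_mult_G:
  assumes g: "g \<in> G" and y: "Lrel y e"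
  shows "Lrel (y * g) e"
proof -
  obtain s where s: "e * g = g" "g * e = g" "s * g = e"
    using g by (auto simp: G_iff Rrel_idempotent_iff[OF ee] Lrel_idempotent_iff[OF ee])
  obtain t where t: "t * y = e" using y Lrel_idempotent_iff[OF ee] by blast
  have "(y * g) * e = y * g" using s(2) by (simp add: mult.assoc)
  moreover have "s * t * (y * g) = s * ((t * y) * g)" by (simp add: mult.assoc)
  then have "s * t * (y * g) = e" by (simp add: t s)
  ultimately show ?thesis using Lrel_idempotent_iff[OF ee] by blast
qed

lemma G_mult: "g \<in> G \<Longrightarrow> h \<in> G \<Longrightarrow> g * h \<in> G"
  using G_mult_Rc[of g h] Lc_mult_G[of h g] by (simp add: G_iff)

lemma st_u_L: "L \<in> I \<Longrightarrow> Lrel (st (u L)) e"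
  using u_R anti_involution_Lrel[OF inv, of _ e] by (simp add: st_e)

lemma Rc_Lclass:
  assumes "Rrel y e"
  shows "Lclass y \<in> I" "Lrel y (u (Lclass y))"
proof -
  have "y \<in> D" using Rc_subset_D assms by blast
  then show I: "Lclass y \<in> I" unfolding Lclasses_in_def by blast
  show "Lrel y (u (Lclass y))" using u_in[OF I] by (simp add: Lclass_def)
qed

lemma I_Lclass:
  assumes "L \<in> I"
  shows "Lclass (u L) = L"
proof -
  obtain x where x: "L = Lclass x" using assms unfolding Lclasses_in_def by blast
  then have "Lrel x (u L)" using u_in[OF assms] by (simp add: Lclass_def)
  then show ?thesis using x Lclass_eq by metis
qed

text \<open>The group \<open>G\<close> acts freely and transitively on each intersection of the
  R-class of \<open>e\<close> with an L-class. Left multiplication by \<open>g\<close> keeps the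
  L-class of \<open>u L\<close>, which recovers \<open>L\<close>; a right factor taking
  \<open>u L\<close> to \<open>e\<close> then recovers \<open>g\<close>.\<close>

lemma bij_Rc: "bij_betw (\<lambda>(L, g). g * u L) (I \<times> G) Rc"
  unfolding bij_betw_def
proof
  have eq: "L = K \<and> g = h" if L: "L \<in> I" "K \<in> I" and gh: "g \<in> G" "h \<in> G"
    and eq: "g * u L = h * u K" for L K g h
  proof -
    have "Lrel (g * u L) (u L)" if LI: "L \<in> I" and gG: "g \<in> G" for L g
    proof -
      obtain s where s: "s * g = e" using gG by (auto simp: G_iff Lrel_idempotent_iff[OF ee])
      have "e * u L = u L" using u_R[OF LI] by (simp add: Rrel_idempotent_iff[OF ee])
      then have "u L = s * (g * u L)" using s by (simp add: mult.assoc[symmetric])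
      then have "leL (u L) (g * u L)" using leL_mult[of s "g * u L"] by simp
      then show ?thesis by (simp add: Lrel_def)
    qed
    then have "Lrel (u L) (u K)" using L gh eq Lrel_sym Lrel_trans by metis
    then have "L = K" using I_Lclass[OF L(1)] I_Lclass[OF L(2)] Lclass_eq by blast
    moreover obtain t where t: "u L * t = e" using u_R[OF L(1)] Rrel_idempotent_iff[OF ee] by blast
    have ge: "g * e = g" "h * e = h" using gh by (auto simp: G_iff Lrel_idempotent_iff[OF ee])
    have "g * (u L * t) = h * (u L * t)" using eq \<open>L = K\<close> by (simp add: mult.assoc[symmetric])
    then have "g = h" unfolding t ge .
    ultimately show ?thesis by simp
  qed
  then show "inj_on (\<lambda>(L, g). g * u L) (I \<times> G)" by (auto simp: inj_on_def)
  show "(\<lambda>(L, g). g * u L) ` (I \<times> G) = Rc"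
  proof
    show "(\<lambda>(L, g). g * u L) ` (I \<times> G) \<subseteq> Rc" using G_mult_Rc u_R by auto
  next
    show "Rc \<subseteq> (\<lambda>(L, g). g * u L) ` (I \<times> G)"
    proof
      fix y assume "y \<in> Rc"
      then have y: "Rrel y e" by simp
      define L where "L = Lclass y"
      have L: "L \<in> I" "Lrel y (u L)" using Rc_Lclass[OF y] L_def by auto
      have ey: "e * y = y" and eu: "e * u L = u L"
        using y u_R[OF L(1)] by (simp_all add: Rrel_idempotent_iff[OF ee])
      \<comment> \<open>A multiplier can be moved into the corner by replacing \<open>s\<close> with
        \<open>e * s * e\<close>; when the two elements coincide, \<open>e\<close> itself serves.
        The multipliers in the two directions turn out to be mutually inverse.\<close>
      have shift: "\<exists>g. e * g = g \<and> g * e = g \<and> v = g * w"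
        if vw: "leL v w" "e * v = v" "e * w = w" for v w
      proof (cases "v = w")
        case True
        then show ?thesis using ee vw by (intro exI[of _ e]) simp
      next
        case False
        then obtain s where "v = s * w" using vw by (auto simp: leL_def)
        then have "v = (e * s * e) * w" using vw by (simp add: mult.assoc)
        moreover have "e * (e * s * e) = e * s * e" "(e * s * e) * e = e * s * e"
          using ee by (simp_all add: mult.assoc[symmetric]) (simp add: mult.assoc)
        ultimately show ?thesis by blast
      qed
      obtain g where g: "e * g = g" "g * e = g" "y = g * u L"
        using shift[of y "u L"] L ey eu by (auto simp: Lrel_def)
      obtain h where h: "e * h = h" "h * e = h" "u L = h * y"
        using shift[of "u L" y] L ey eu by (auto simp: Lrel_def)
      obtain s where s: "u L * s = e" using u_R[OF L(1)] Rrel_idempotent_iff[OF ee] by blast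
      obtain t where t: "y * t = e" using y Rrel_idempotent_iff[OF ee] by blast
      have "h * g * (u L * s) = h * (g * u L) * s" by (simp add: mult.assoc)
      also have "\<dots> = u L * s" by (simp only: g(3)[symmetric] h(3)[symmetric])
      finally have hg: "h * g = e" using g s by (simp add: mult.assoc)
      have "g * h * (y * t) = g * (h * y) * t" by (simp add: mult.assoc)
      also have "\<dots> = y * t" by (simp only: g(3)[symmetric] h(3)[symmetric])
      finally have gh: "g * h = e" using h t by (simp add: mult.assoc)
      have "g \<in> G" unfolding G_iff Rrel_idempotent_iff[OF ee] Lrel_idempotent_iff[OF ee]
        using g gh hg by blast
      then show "y \<in> (\<lambda>(L, g). g * u L) ` (I \<times> G)" using L g by force
    qed
  qed
qed

text \<open>The anti-involution turns representatives of L-classes into representatives of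
  R-classes, all within the L-class of \<open>e\<close>. Together with \<open>bij_Rc\<close> this
  gives each element of \<open>D\<close> unique coordinates
  \<open>st (u K) * g * u M\<close>.\<close>

lemma bij_D: "bij_betw (\<lambda>(L, y). st (u L) * y) (I \<times> Rc) D"
  unfolding bij_betw_def
proof
  have stu: "\<exists>p. p * st (u L) = e" "st (u L) * e = st (u L)" if "L \<in> I" for L
    using st_u_L[OF that] Lrel_idempotent_iff[OF ee] by blast+
  have R: "Rrel (st (u L) * y) (st (u L))" if L: "L \<in> I" and y: "Rrel y e" for L y
  proof -
    obtain t where t: "y * t = e" using y Rrel_idempotent_iff[OF ee] by blast
    have "(st (u L) * y) * t = st (u L)" using t stu[OF L] by (simp add: mult.assoc)
    then show ?thesis unfolding Rrel_def leR_def by metis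
  qed
  have eq: "L = K \<and> y = z" if L: "L \<in> I" "K \<in> I" and yz: "Rrel y e" "Rrel z e"
    and eq: "st (u L) * y = st (u K) * z" for L K y z
  proof -
    have "Rrel (st (u L)) (st (u K))" using R[OF L(1) yz(1)] R[OF L(2) yz(2)] eq
      by (metis Rrel_sym Rrel_trans)
    then have "Lrel (u L) (u K)" using anti_involution_Rrel[OF inv] by blast
    then have "L = K" using I_Lclass[OF L(1)] I_Lclass[OF L(2)] Lclass_eq by blast
    moreover obtain p where p: "p * st (u L) = e" using stu L by blast
    have ey: "e * y = y" "e * z = z" using yz by (auto simp: Rrel_idempotent_iff[OF ee])
    have "(p * st (u L)) * y = (p * st (u L)) * z" using eq \<open>L = K\<close> by (simp add: mult.assoc)
    then have "y = z" unfolding p ey .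
    ultimately show ?thesis by simp
  qed
  then show "inj_on (\<lambda>(L, y). st (u L) * y) (I \<times> Rc)" by (auto simp: inj_on_def)
  show "(\<lambda>(L, y). st (u L) * y) ` (I \<times> Rc) = D"
  proof
    have "st (u L) * y \<in> D" if "L \<in> I" "Rrel y e" for L y
    proof -
      have "leJ e (st (u L) * y)"
        using R[OF that] st_u_L[OF that(1)] leL_imp_leJ leR_imp_leJ leJ_trans
        unfolding Rrel_def Lrel_def by blast
      moreover have "leJ (st (u L) * y) e"
        using R[OF that] st_u_L[OF that(1)] leL_imp_leJ leR_imp_leJ leJ_trans
        unfolding Rrel_def Lrel_def by blast
      ultimately show ?thesis by (simp add: D_iff)
    qed
    then show "(\<lambda>(L, y). st (u L) * y) ` (I \<times> Rc) \<subseteq> D" by auto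
  next
    show "D \<subseteq> (\<lambda>(L, y). st (u L) * y) ` (I \<times> Rc)"
    proof
      fix x assume "x \<in> D"
      then have "Drel x e" using Drel_sym by (simp add: Dclass_def)
      then obtain z where z: "Rrel x z" "Lrel z e" unfolding Drel_def by blast
      have stz: "Rrel (st z) e" using z(2) anti_involution_Rrel[OF inv, of z e] by (simp add: st_e)
      define L where "L = Lclass (st z)"
      have L: "L \<in> I" "Lrel (st z) (u L)" using Rc_Lclass[OF stz] L_def by auto
      have "Rrel (st (st z)) (st (u L))" using L(2) anti_involution_Rrel[OF inv] by blast
      then have x: "Rrel x (st (u L))" using z(1) inv Rrel_trans by (simp add: anti_involution_def)
      obtain p where p: "p * st (u L) = e" using stu L by blast
      \<comment> \<open>Left multiplication by \<open>p\<close> carries the R-class of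
        \<open>st (u L)\<close> to that of \<open>e\<close>, and left multiplication by
        \<open>st (u L)\<close> undoes it.\<close>
      define y where "y = p * x"
      have "Rrel (p * x) (p * st (u L))" using x leR_mult_left unfolding Rrel_def by blast
      then have y: "Rrel y e" unfolding y_def p .
      have "st (u L) * y = x"
      proof (cases "x = st (u L)")
        case True
        then show ?thesis using p stu(2)[OF L(1)] by (simp add: y_def)
      next
        case False
        then obtain s where s: "x = st (u L) * s" using x by (auto simp: Rrel_def leR_def)
        have "st (u L) * y = st (u L) * (p * st (u L)) * s" by (simp add: y_def s mult.assoc)
        then show ?thesis unfolding p stu(2)[OF L(1)] s .
      qed
      then show "x \<in> (\<lambda>(L, y). st (u L) * y) ` (I \<times> Rc)" using L(1) y by force
    qed
  qed
qed

end

section \<open>Twisted semigroup algebras\<close>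

definition delta :: "'a \<Rightarrow> 'a \<Rightarrow> 'r::field" where
  "delta x = (\<lambda>z. if z = x then 1 else 0)"

lemma sum_fun_apply: "(\<Sum>i\<in>I. f i) z = (\<Sum>i\<in>I. f i z)"
  for f :: "'i \<Rightarrow> 'a \<Rightarrow> 'r::comm_monoid_add"
  by (induction I rule: infinite_finite_induct) auto

lemma tw_mult_altdef:
  "tw_mult \<alpha> f g z = (\<Sum>x\<in>UNIV. \<Sum>y\<in>UNIV. if x * y = z then f x * g y * \<alpha> x y else 0)"
proof -
  have "(\<Sum>x\<in>UNIV. \<Sum>y\<in>UNIV. if x * y = z then f x * g y * \<alpha> x y else 0)
      = (\<Sum>p\<in>UNIV. if fst p * snd p = z then f (fst p) * g (snd p) * \<alpha> (fst p) (snd p) else 0)"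
    by (simp add: sum.cartesian_product split_def)
  also have "\<dots> = tw_mult \<alpha> f g z"
    unfolding tw_mult_def by (simp add: sum.If_cases)
  finally show ?thesis by simp
qed

text \<open>Pairing a product with an arbitrary weight \<open>k\<close> amounts to grouping pairs by
  their product. Both bracketings of a triple product are such pairings, which reduces associativity
  to comparing summands.\<close>

lemma sum_tw_mult:
  fixes \<alpha> :: "'a::{finite,semigroup_mult} \<Rightarrow> 'a \<Rightarrow> 'r::field"
  shows "(\<Sum>w\<in>UNIV. tw_mult \<alpha> f g w * k w) = (\<Sum>x\<in>UNIV. \<Sum>y\<in>UNIV. f x * g y * \<alpha> x y * k (x * y))"
proof -
  define m :: "'a \<times> 'a \<Rightarrow> 'a" where "m p = fst p * snd p" for p
  define h where "h p = f (fst p) * g (snd p) * \<alpha> (fst p) (snd p) * k (m p)" for p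
  have "(\<Sum>w\<in>UNIV. tw_mult \<alpha> f g w * k w) = (\<Sum>w\<in>UNIV. sum h {p \<in> UNIV. m p = w})"
    by (intro sum.cong refl) (simp add: tw_mult_def m_def h_def sum_distrib_right)
  also have "\<dots> = sum h UNIV" by (rule sum.group) auto
  also have "\<dots> = (\<Sum>x\<in>UNIV. \<Sum>y\<in>UNIV. f x * g y * \<alpha> x y * k (x * y))"
    by (simp add: h_def m_def sum.cartesian_product split_def)
  finally show ?thesis .
qed

lemma tw_mult_assoc:
  assumes "twisting \<alpha>"
  shows "tw_mult \<alpha> (tw_mult \<alpha> f g) h = tw_mult \<alpha> f (tw_mult \<alpha> g h)"
proof
  fix z
  have "tw_mult \<alpha> (tw_mult \<alpha> f g) h z =
      (\<Sum>w\<in>UNIV. tw_mult \<alpha> f g w * (\<Sum>t\<in>UNIV. if w * t = z then h t * \<alpha> w t else 0))"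
    unfolding tw_mult_altdef[of \<alpha> "tw_mult \<alpha> f g"] sum_distrib_left
    by (intro sum.cong refl) simp
  also have "\<dots> = (\<Sum>x\<in>UNIV. \<Sum>y\<in>UNIV. \<Sum>t\<in>UNIV.
      if x * (y * t) = z then f x * g y * h t * (\<alpha> x y * \<alpha> (x * y) t) else 0)"
    unfolding sum_tw_mult unfolding sum_distrib_left by (intro sum.cong refl) (simp add: mult.assoc)
  \<comment> \<open>Here the twisting identity exchanges the two products of scalars, term by
    term.\<close>
  also have "\<dots> = (\<Sum>x\<in>UNIV. \<Sum>y\<in>UNIV. \<Sum>t\<in>UNIV.
      f x * (g y * h t * \<alpha> y t * (if x * (y * t) = z then \<alpha> x (y * t) else 0)))"
    using assms unfolding twisting_def by (intro sum.cong refl) simp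
  also have "\<dots> = (\<Sum>x\<in>UNIV. f x *
      (\<Sum>w\<in>UNIV. tw_mult \<alpha> g h w * (if x * w = z then \<alpha> x w else 0)))"
    unfolding sum_tw_mult unfolding sum_distrib_left ..
  also have "\<dots> = tw_mult \<alpha> f (tw_mult \<alpha> g h) z"
    unfolding tw_mult_altdef[of \<alpha> f] sum_distrib_left
    by (intro sum.cong refl) simp
  finally show "tw_mult \<alpha> (tw_mult \<alpha> f g) h z = tw_mult \<alpha> f (tw_mult \<alpha> g h) z" .
qed

lemma sum_scaled_delta: "(\<Sum>x\<in>UNIV. (\<lambda>z. c x * delta x z)) = c"
  for c :: "'a::finite \<Rightarrow> 'r::field"
  by (rule ext) (simp add: sum_fun_apply delta_def if_distrib cong: if_cong)

interpretation fun_vs: vector_space "\<lambda>c f z. c * f z :: 'r::field"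
  by unfold_locales (auto simp: algebra_simps)

lemma inj_delta: "inj (delta :: 'a \<Rightarrow> 'a \<Rightarrow> 'r::field)"
  by (auto simp: inj_def delta_def fun_eq_iff split: if_splits)

interpretation fun_fd: finite_dimensional_vector_space
  "\<lambda>c f z. c * f z :: 'r::field" "range (delta :: 'a::finite \<Rightarrow> 'a \<Rightarrow> 'r)"
proof
  show "finite (range (delta :: 'a \<Rightarrow> 'a \<Rightarrow> 'r))" by simp
  show "fun_vs.independent (range (delta :: 'a \<Rightarrow> 'a \<Rightarrow> 'r))"
  proof (rule fun_vs.independent_if_scalars_zero)
    fix c :: "('a \<Rightarrow> 'r) \<Rightarrow> 'r" and x
    assume "(\<Sum>v\<in>range delta. (\<lambda>z. c v * v z)) = 0" and x: "x \<in> range (delta :: 'a \<Rightarrow> 'a \<Rightarrow> 'r)"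
    then have "(\<Sum>y\<in>UNIV. (\<lambda>z. c (delta y) * delta y z)) = (0 :: 'a \<Rightarrow> 'r)"
      by (simp add: sum.reindex[OF inj_delta] o_def)
    then have "(\<lambda>y::'a. c (delta y)) = 0" unfolding sum_scaled_delta .
    then show "c x = 0" using x by (auto simp: fun_eq_iff)
  qed simp
  show "fun_vs.span (range (delta :: 'a \<Rightarrow> 'a \<Rightarrow> 'r)) = UNIV"
  proof -
    have "(f :: 'a \<Rightarrow> 'r) \<in> fun_vs.span (range delta)" for f
      by (subst sum_scaled_delta[of f, symmetric])
        (intro fun_vs.span_sum fun_vs.span_scale fun_vs.span_base, simp)
    then show ?thesis by blast
  qed
qed

locale twisted_algebra =
  fixes \<alpha> :: "'a::{finite,semigroup_mult} \<Rightarrow> 'a \<Rightarrow> 'r::field"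
  assumes tw: "twisting \<alpha>"
begin

abbreviation tw_times (infixl "\<star>" 70) where "f \<star> g \<equiv> tw_mult \<alpha> f g"

sublocale fd_algebra "\<lambda>c f z. c * f z" "range delta" "tw_mult \<alpha>"
proof
  show "(f \<star> g) \<star> h = f \<star> (g \<star> h)" for f g h by (rule tw_mult_assoc[OF tw])
  show "(f + g) \<star> h = f \<star> h + g \<star> h" for f g h
    by (rule ext) (simp add: tw_mult_def algebra_simps sum.distrib)
  show "f \<star> (g + h) = f \<star> g + f \<star> h" for f g h
    by (rule ext) (simp add: tw_mult_def algebra_simps sum.distrib)
  show "(\<lambda>z. c * f z) \<star> g = (\<lambda>z. c * (f \<star> g) z)" for c f g
    by (rule ext) (simp add: tw_mult_def algebra_simps sum_distrib_left)
  show "f \<star> (\<lambda>z. c * g z) = (\<lambda>z. c * (f \<star> g) z)" for c f g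
    by (rule ext) (simp add: tw_mult_def algebra_simps sum_distrib_left)
qed

lemma subspace_subalg: "fun_vs.subspace (subalg X)"
  by (simp add: fun_vs.subspace_def subalg_def)

lemma subalg_eqI:
  assumes "f \<in> subalg X" "g \<in> subalg X" "\<And>x. x \<in> X \<Longrightarrow> f x = g x"
  shows "f = g"
proof
  show "f x = g x" for x using assms by (cases "x \<in> X") (auto simp: subalg_def)
qed

lemma zero_subalg [simp]: "0 \<in> subalg X"
  by (simp add: subalg_def)

lemma sum_subalg: "(\<And>i. i \<in> I \<Longrightarrow> f i \<in> subalg X) \<Longrightarrow> (\<Sum>i\<in>I. f i) \<in> subalg X"
  by (simp add: fun_vs.subspace_sum subspace_subalg)

lemma delta_subalg: "delta x \<in> subalg X \<longleftrightarrow> x \<in> X"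
  by (auto simp: subalg_def delta_def)

lemma mult_subalg:
  assumes f: "f \<in> subalg X" and g: "g \<in> subalg Y" and XY: "\<And>x y. x \<in> X \<Longrightarrow> y \<in> Y \<Longrightarrow> x * y \<in> Z"
  shows "f \<star> g \<in> subalg Z"
proof -
  have "f x * g y * \<alpha> x y = 0" if "x * y \<notin> Z" for x y
    using that f g XY by (cases "x \<in> X"; cases "y \<in> Y") (auto simp: subalg_def)
  then have "(f \<star> g) z = 0" if "z \<notin> Z" for z
    unfolding tw_mult_def using that by (intro sum.neutral) auto
  then show ?thesis by (simp add: subalg_def)
qed

lemma delta_mult: "(delta a \<star> f) z = (\<Sum>y\<in>UNIV. if a * y = z then f y * \<alpha> a y else 0)"
proof -
  have "(delta a \<star> f) z = (\<Sum>x\<in>UNIV. if x = a then (\<Sum>y\<in>UNIV. if a * y = z then f y * \<alpha> a y else 0) else 0)"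
    unfolding tw_mult_altdef by (intro sum.cong) (auto simp: delta_def cong: if_cong)
  then show ?thesis by simp
qed

lemma mult_delta: "(f \<star> delta a) z = (\<Sum>x\<in>UNIV. if x * a = z then f x * \<alpha> x a else 0)"
proof -
  have "(if x * y = z then f x * delta a y * \<alpha> x y else 0)
      = (if y = a then if x * a = z then f x * \<alpha> x a else 0 else 0)" for x y
    by (auto simp: delta_def)
  then show ?thesis unfolding tw_mult_altdef by simp
qed

lemma delta_mult_delta: "delta x \<star> delta y = (\<lambda>z. if z = x * y then \<alpha> x y else 0)"
proof
  fix z
  have "(delta x \<star> delta y) z = (\<Sum>w\<in>UNIV. if w = y then (if z = x * y then \<alpha> x y else 0) else 0)"
    unfolding delta_mult by (intro sum.cong) (auto simp: delta_def)
  then show "(delta x \<star> delta y) z = (if z = x * y then \<alpha> x y else 0)" by simp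
qed

text \<open>If \<open>f A f = 0\<close>, then \<open>K = {g. f A g = 0}\<close> and \<open>N = {h \<in> K. h A K = 0}\<close> are two-sided ideals
  containing \<open>f\<close>, and \<open>N\<^sup>3 = 0\<close>.\<close>

lemma semiprime_on_if_semisimple:
  assumes A: "fun_vs.subspace A" "\<And>f g. f \<in> A \<Longrightarrow> g \<in> A \<Longrightarrow> f \<star> g \<in> A"
    and ss: "semisimple \<alpha> A"
  shows "semiprime_on A"
  unfolding semiprime_on_def
proof (intro ballI impI)
  fix f assume f: "f \<in> A" and fAf: "\<forall>a\<in>A. f \<star> (a \<star> f) = 0"
  define K where "K = {g \<in> A. \<forall>a\<in>A. f \<star> (a \<star> g) = 0}"
  define N where "N = {h \<in> K. \<forall>a\<in>A. \<forall>g\<in>K. h \<star> (a \<star> g) = 0}"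
  have A0: "0 \<in> A" and Aadd: "\<And>g h. g \<in> A \<Longrightarrow> h \<in> A \<Longrightarrow> g + h \<in> A"
    and Ascale: "\<And>c g. g \<in> A \<Longrightarrow> (\<lambda>z. c * g z) \<in> A"
    using A(1) unfolding fun_vs.subspace_def by blast+
  have K0: "0 \<in> K" and Kadd: "\<And>g h. g \<in> K \<Longrightarrow> h \<in> K \<Longrightarrow> g + h \<in> K"
    and Kscale: "\<And>c g. g \<in> K \<Longrightarrow> (\<lambda>z. c * g z) \<in> K"
    using A0 Aadd Ascale by (auto simp: K_def add_right scale_right)
  have KA: "g \<star> a \<in> K" and AK: "a \<star> g \<in> K" if "g \<in> K" "a \<in> A" for g a
  proof -
    have "f \<star> (b \<star> (g \<star> a)) = (f \<star> (b \<star> g)) \<star> a" "f \<star> (b \<star> (a \<star> g)) = f \<star> ((b \<star> a) \<star> g)" for b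
      by (simp_all only: assoc)
    then show "g \<star> a \<in> K" "a \<star> g \<in> K" using that A(2) by (auto simp: K_def)
  qed
  have NA: "h \<star> a \<in> N" and AN: "a \<star> h \<in> N" if h: "h \<in> N" and a: "a \<in> A" for h a
  proof -
    have "(h \<star> a) \<star> (b \<star> g) = h \<star> ((a \<star> b) \<star> g)" "(a \<star> h) \<star> (b \<star> g) = a \<star> (h \<star> (b \<star> g))" for b g
      by (simp_all only: assoc)
    then show "h \<star> a \<in> N" "a \<star> h \<in> N" using h a A(2) KA AK by (auto simp: N_def)
  qed
  have NAsub: "N \<subseteq> A" by (auto simp: N_def K_def)
  have N0: "0 \<in> N" using K0 by (auto simp: N_def)
  have Nadd: "g + h \<in> N" if "g \<in> N" "h \<in> N" for g h
    using that Kadd by (auto simp: N_def add_left)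
  have Nscale: "(\<lambda>z. c * g z) \<in> N" if "g \<in> N" for c g
    using that Kscale by (auto simp: N_def scale_left zero_fun_def)
  have "is_ideal \<alpha> A N"
    unfolding is_ideal_def
    by (intro conjI ballI allI NAsub Nscale NA AN N0[unfolded zero_fun_def] Nadd[unfolded plus_fun_def])
  moreover have "nilpotent_ideal \<alpha> N"
    unfolding nilpotent_ideal_def
  \<comment> \<open>The exponent is three because \<open>A\<close> is not assumed to have a unit:
    the middle factor takes the place of the arbitrary \<open>a\<close> in the definition of
    \<open>N\<close>.\<close>
  proof (intro exI[of _ 3] conjI allI impI)
    fix fs assume fs: "length fs = 3 \<and> set fs \<subseteq> N"
    then obtain p q r where "fs = [p, q, r]"
      by (auto simp: numeral_3_eq_3 length_Suc_conv)
    with fs show "tw_prod \<alpha> fs = (\<lambda>_. 0)" by (auto simp: N_def K_def zero_fun_def[symmetric])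
  qed simp
  ultimately have "N = {0}" using ss unfolding semisimple_def by (simp add: zero_fun_def)
  moreover have "f \<in> N" using f fAf by (auto simp: N_def K_def)
  ultimately show "f = 0" by blast
qed

lemma tw_prod_snoc: "fs \<noteq> [] \<Longrightarrow> tw_prod \<alpha> (fs @ [g]) = tw_prod \<alpha> fs \<star> g"
proof (induction fs)
  case (Cons f fs)
  then show ?case by (cases fs) (auto simp: assoc)
qed simp

text \<open>If all \<open>n+1\<close>-fold products in \<open>N\<close> vanish, an \<open>n\<close>-fold product \<open>p\<close> satisfies
  \<open>p a p = 0\<close>, since \<open>a p \<in> N\<close>; hence the \<open>n\<close>-fold products vanish too.\<close>

lemma semisimple_if_semiprime_on:
  assumes sp: "semiprime_on A"
  shows "semisimple \<alpha> A"
  unfolding semisimple_def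
proof (intro allI impI)
  fix N assume N: "is_ideal \<alpha> A N \<and> nilpotent_ideal \<alpha> N"
  have prodN: "fs \<noteq> [] \<Longrightarrow> set fs \<subseteq> N \<Longrightarrow> tw_prod \<alpha> fs \<in> N" for fs
  proof (induction fs)
    case (Cons f fs)
    have f: "f \<in> N" and A: "f \<in> A" using Cons.prems N unfolding is_ideal_def by auto
    show ?case
    proof (cases fs)
      case (Cons g gs)
      then have "tw_prod \<alpha> fs \<in> N" using Cons.IH Cons.prems by auto
      then have "f \<star> tw_prod \<alpha> fs \<in> N" using A N unfolding is_ideal_def by blast
      then show ?thesis using Cons by simp
    qed (use f in simp)
  qed simp
  obtain n where n: "n \<ge> 1" "\<And>fs. length fs = n \<Longrightarrow> set fs \<subseteq> N \<Longrightarrow> tw_prod \<alpha> fs = (\<lambda>_. 0)"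
    using N unfolding nilpotent_ideal_def by blast
  have step: "tw_prod \<alpha> fs = (\<lambda>_. 0)"
    if ne: "fs \<noteq> []" and fs: "set fs \<subseteq> N"
      and IH: "\<And>gs. length gs = Suc (length fs) \<Longrightarrow> set gs \<subseteq> N \<Longrightarrow> tw_prod \<alpha> gs = (\<lambda>_. 0)"
    for fs
  proof -
    let ?p = "tw_prod \<alpha> fs"
    have p: "?p \<in> N" using prodN ne fs by blast
    have "?p \<star> (a \<star> ?p) = 0" if "a \<in> A" for a
    proof -
      have "a \<star> ?p \<in> N" using that p N unfolding is_ideal_def by blast
      then have "tw_prod \<alpha> (fs @ [a \<star> ?p]) = (\<lambda>_. 0)" using fs by (intro IH) auto
      then show ?thesis unfolding tw_prod_snoc[OF ne] zero_fun_def .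
    qed
    moreover have "?p \<in> A" using p N unfolding is_ideal_def by blast
    ultimately have "?p = 0" using sp unfolding semiprime_on_def by blast
    then show ?thesis by (simp only: zero_fun_def)
  qed
  \<comment> \<open>Vanishing descends from length \<open>n\<close> to length one, and lists of
    length one are the elements of \<open>N\<close> themselves.\<close>
  have "1 \<le> n \<Longrightarrow> (\<And>fs. length fs = n \<Longrightarrow> set fs \<subseteq> N \<Longrightarrow> tw_prod \<alpha> fs = (\<lambda>_. 0)) \<Longrightarrow>
      f \<in> N \<Longrightarrow> f = (\<lambda>_. 0)" for n f
  proof (induction n rule: nat_induct_at_least)
    case base
    then show ?case using base(1)[of "[f]"] by simp
  next
    case (Suc n)
    show ?case
    proof (rule Suc.IH)
      fix fs assume fs: "length fs = n" "set fs \<subseteq> N"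
      then have "fs \<noteq> []" using Suc.hyps by auto
      then show "tw_prod \<alpha> fs = (\<lambda>_. 0)" using fs(2)
        by (rule step) (use Suc.prems(1) fs(1) in simp)
    qed (rule Suc.prems)
  qed
  from this[OF n] have "N \<subseteq> {\<lambda>_. 0}" by blast
  moreover have "(\<lambda>_. 0) \<in> N" using N unfolding is_ideal_def by blast
  ultimately show "N = {\<lambda>_. 0}" by blast
qed

section \<open>Coordinates relative to a unique factorisation of basis elements\<close>

lemma left_coords_apply:
  assumes inj: "inj_on (\<lambda>(i, y). a i * y) (I \<times> Y)" and I: "finite I"
    and v: "\<And>j. j \<in> I \<Longrightarrow> v j \<in> subalg Y" and i: "i \<in> I" and y: "y \<in> Y"
  shows "(\<Sum>j\<in>I. delta (a j) \<star> v j) (a i * y) = v i y * \<alpha> (a i) y"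
proof -
  have "(delta (a j) \<star> v j) (a i * y) = (if j = i then v i y * \<alpha> (a i) y else 0)" if j: "j \<in> I" for j
  proof -
    \<comment> \<open>By injectivity only the pair \<open>(i, y)\<close> contributes to the
      coefficient at \<open>a i * y\<close>.\<close>
    have "(if a j * y' = a i * y then v j y' * \<alpha> (a j) y' else 0)
        = (if y' = y then if j = i then v i y * \<alpha> (a i) y else 0 else 0)" for y'
      using inj_onD[OF inj, of "(j, y')" "(i, y)"] v[OF j] i j y
      by (cases "y' \<in> Y") (auto simp: subalg_def)
    then show ?thesis unfolding delta_mult by simp
  qed
  then show ?thesis using I i by (simp add: sum_fun_apply)
qed

lemma left_coords_unique:
  assumes inj: "inj_on (\<lambda>(i, y). a i * y) (I \<times> Y)" and I: "finite I"
    and nz: "\<And>i y. i \<in> I \<Longrightarrow> y \<in> Y \<Longrightarrow> \<alpha> (a i) y \<noteq> 0"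
    and v: "\<And>j. j \<in> I \<Longrightarrow> v j \<in> subalg Y" and w: "\<And>j. j \<in> I \<Longrightarrow> w j \<in> subalg Y"
    and eq: "(\<Sum>j\<in>I. delta (a j) \<star> v j) = (\<Sum>j\<in>I. delta (a j) \<star> w j)" and i: "i \<in> I"
  shows "v i = w i"
proof
  fix y
  show "v i y = w i y"
  proof (cases "y \<in> Y")
    case True
    then show ?thesis
      using left_coords_apply[where v=v, OF inj I v i True]
        left_coords_apply[where v=w, OF inj I w i True] eq nz[OF i True]
      by simp
  next
    case False
    then show ?thesis using v[OF i] w[OF i] by (simp add: subalg_def)
  qed
qed

lemma left_coords_exist:
  assumes bij: "bij_betw (\<lambda>(i, y). a i * y) (I \<times> Y) X" and I: "finite I"
    and nz: "\<And>i y. i \<in> I \<Longrightarrow> y \<in> Y \<Longrightarrow> \<alpha> (a i) y \<noteq> 0" and f: "f \<in> subalg X"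
  obtains v where "\<And>j. v j \<in> subalg Y" "f = (\<Sum>j\<in>I. delta (a j) \<star> v j)"
proof -
  \<comment> \<open>Each coefficient of \<open>f\<close> arises from a single factorisation, so the
    coordinate is found by dividing by the nonzero twisting scalar.\<close>
  define v where "v j = (\<lambda>y. if y \<in> Y then f (a j * y) / \<alpha> (a j) y else 0)" for j
  have v: "v j \<in> subalg Y" for j by (simp add: v_def subalg_def)
  have inj: "inj_on (\<lambda>(i, y). a i * y) (I \<times> Y)" using bij by (simp add: bij_betw_def)
  have X: "a i * y \<in> X" if "i \<in> I" "y \<in> Y" for i y
    using bij_betw_apply[OF bij, of "(i, y)"] that by simp
  have "(\<Sum>j\<in>I. delta (a j) \<star> v j) \<in> subalg X"
    by (intro sum_subalg mult_subalg[where X="{a j}" and Y=Y for j]) (auto simp: delta_subalg v X)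
  moreover have "f x = (\<Sum>j\<in>I. delta (a j) \<star> v j) x" if "x \<in> X" for x
  proof -
    obtain i y where "i \<in> I" "y \<in> Y" "x = a i * y"
      using \<open>x \<in> X\<close> bij by (auto simp: bij_betw_def)
    then show ?thesis using left_coords_apply[OF inj I v, of i y] nz[of i y] by (simp add: v_def)
  qed
  ultimately have "f = (\<Sum>j\<in>I. delta (a j) \<star> v j)"
    using f by (intro subalg_eqI[of f X])
  then show thesis using that v by blast
qed

lemma right_coords_apply:
  assumes inj: "inj_on (\<lambda>(i, y). y * a i) (I \<times> Y)" and I: "finite I"
    and v: "\<And>j. j \<in> I \<Longrightarrow> v j \<in> subalg Y" and i: "i \<in> I" and y: "y \<in> Y"
  shows "(\<Sum>j\<in>I. v j \<star> delta (a j)) (y * a i) = v i y * \<alpha> y (a i)"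
proof -
  have "(v j \<star> delta (a j)) (y * a i) = (if j = i then v i y * \<alpha> y (a i) else 0)" if j: "j \<in> I" for j
  proof -
    have "(if y' * a j = y * a i then v j y' * \<alpha> y' (a j) else 0)
        = (if y' = y then if j = i then v i y * \<alpha> y (a i) else 0 else 0)" for y'
      using inj_onD[OF inj, of "(j, y')" "(i, y)"] v[OF j] i j y
      by (cases "y' \<in> Y") (auto simp: subalg_def)
    then show ?thesis unfolding mult_delta by simp
  qed
  then show ?thesis using I i by (simp add: sum_fun_apply)
qed

lemma right_coords_unique:
  assumes inj: "inj_on (\<lambda>(i, y). y * a i) (I \<times> Y)" and I: "finite I"
    and nz: "\<And>i y. i \<in> I \<Longrightarrow> y \<in> Y \<Longrightarrow> \<alpha> y (a i) \<noteq> 0"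
    and v: "\<And>j. j \<in> I \<Longrightarrow> v j \<in> subalg Y" and w: "\<And>j. j \<in> I \<Longrightarrow> w j \<in> subalg Y"
    and eq: "(\<Sum>j\<in>I. v j \<star> delta (a j)) = (\<Sum>j\<in>I. w j \<star> delta (a j))" and i: "i \<in> I"
  shows "v i = w i"
proof
  fix y
  show "v i y = w i y"
  proof (cases "y \<in> Y")
    case True
    then show ?thesis
      using right_coords_apply[where v=v, OF inj I v i True]
        right_coords_apply[where v=w, OF inj I w i True] eq nz[OF i True]
      by simp
  next
    case False
    then show ?thesis using v[OF i] w[OF i] by (simp add: subalg_def)
  qed
qed

lemma right_coords_exist:
  assumes bij: "bij_betw (\<lambda>(i, y). y * a i) (I \<times> Y) X" and I: "finite I"
    and nz: "\<And>i y. i \<in> I \<Longrightarrow> y \<in> Y \<Longrightarrow> \<alpha> y (a i) \<noteq> 0" and f: "f \<in> subalg X"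
  obtains v where "\<And>j. v j \<in> subalg Y" "f = (\<Sum>j\<in>I. v j \<star> delta (a j))"
proof -
  define v where "v j = (\<lambda>y. if y \<in> Y then f (y * a j) / \<alpha> y (a j) else 0)" for j
  have v: "v j \<in> subalg Y" for j by (simp add: v_def subalg_def)
  have inj: "inj_on (\<lambda>(i, y). y * a i) (I \<times> Y)" using bij by (simp add: bij_betw_def)
  have X: "y * a i \<in> X" if "i \<in> I" "y \<in> Y" for i y
    using bij_betw_apply[OF bij, of "(i, y)"] that by simp
  have "(\<Sum>j\<in>I. v j \<star> delta (a j)) \<in> subalg X"
    by (intro sum_subalg mult_subalg[where X=Y and Y="{a j}" for j]) (auto simp: delta_subalg v X)
  moreover have "f x = (\<Sum>j\<in>I. v j \<star> delta (a j)) x" if "x \<in> X" for x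
  proof -
    obtain i y where "i \<in> I" "y \<in> Y" "x = y * a i"
      using \<open>x \<in> X\<close> bij by (auto simp: bij_betw_def)
    then show ?thesis using right_coords_apply[OF inj I v, of i y] nz[of i y] by (simp add: v_def)
  qed
  ultimately have "f = (\<Sum>j\<in>I. v j \<star> delta (a j))"
    using f by (intro subalg_eqI[of f X])
  then show thesis using that v by blast
qed

end

section \<open>Semisimplicity and the sandwich matrix\<close>

locale twisted_Dclass = twisted_algebra \<alpha> + pointed_Dclass st e u
  for \<alpha> :: "'a::{finite,semigroup_mult} \<Rightarrow> 'a \<Rightarrow> 'r::field"
    and st :: "'a \<Rightarrow> 'a" and e :: 'a and u :: "'a set \<Rightarrow> 'a" +
  assumes nz: "Lrel x e \<Longrightarrow> Rrel y e \<Longrightarrow> \<alpha> x y \<noteq> 0"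
begin

section \<open>Calculus modulo the classes strictly below \<open>D\<close>\<close>

abbreviation "B \<equiv> (subalg G :: ('a \<Rightarrow> 'r) set)"
abbreviation "Pm \<equiv> Pmat \<alpha> st u G"

text \<open>Equality in the quotient by the ideal spanned by the elements strictly below
  \<open>D\<close>, expressed without forming the quotient.\<close>

definition cong_below :: "('a \<Rightarrow> 'r) \<Rightarrow> ('a \<Rightarrow> 'r) \<Rightarrow> bool" (infix "\<approx>" 50) where
  "f \<approx> g \<longleftrightarrow> f - g \<in> subalg below"

lemma diff_subalg: "f \<in> subalg X \<Longrightarrow> g \<in> subalg X \<Longrightarrow> f - g \<in> subalg X"
  by (rule fun_vs.subspace_diff[OF subspace_subalg])

lemma subalg_mono: "f \<in> subalg X \<Longrightarrow> X \<subseteq> Y \<Longrightarrow> f \<in> subalg Y"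
  by (auto simp: subalg_def)

lemma subalg_disjoint: "f \<in> subalg X \<Longrightarrow> f \<in> subalg Y \<Longrightarrow> X \<inter> Y = {} \<Longrightarrow> f = 0"
  unfolding subalg_def by (rule ext) fastforce

lemma cong_trans [trans]: "f \<approx> g \<Longrightarrow> g \<approx> h \<Longrightarrow> f \<approx> h"
  unfolding cong_below_def subalg_def by auto

lemma eq_cong_trans [trans]: "f = g \<Longrightarrow> g \<approx> h \<Longrightarrow> f \<approx> h"
  and cong_eq_trans [trans]: "f \<approx> g \<Longrightarrow> g = h \<Longrightarrow> f \<approx> h"
  by simp_all

lemma cong_sym: "f \<approx> g \<Longrightarrow> g \<approx> f"
  unfolding cong_below_def subalg_def by auto

lemma below_ideal:
  "f \<in> subalg below \<Longrightarrow> g \<star> f \<in> subalg below" "f \<in> subalg below \<Longrightarrow> f \<star> g \<in> subalg below"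
  by (erule mult_subalg[where X=UNIV, rotated], erule below_mult(1), simp add: subalg_def)
    (erule mult_subalg[where Y=UNIV], simp add: subalg_def, erule below_mult(2))

lemma cong_mult_left: "f \<approx> g \<Longrightarrow> h \<star> f \<approx> h \<star> g"
  unfolding cong_below_def diff_right[symmetric] by (rule below_ideal)

lemma cong_mult_right: "f \<approx> g \<Longrightarrow> f \<star> h \<approx> g \<star> h"
  unfolding cong_below_def diff_left[symmetric] by (rule below_ideal)

lemma cong_sum: "(\<And>i. i \<in> A \<Longrightarrow> f i \<approx> g i) \<Longrightarrow> (\<Sum>i\<in>A. f i) \<approx> (\<Sum>i\<in>A. g i)"
  unfolding cong_below_def sum_subtractf[symmetric] by (rule sum_subalg)

text \<open>\<open>D\<close> is disjoint from the elements strictly below it. This turns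
  computations modulo lower classes into exact identities.\<close>

lemma cong_eq: "f \<in> subalg D \<Longrightarrow> g \<in> subalg D \<Longrightarrow> f \<approx> g \<Longrightarrow> f = g"
  unfolding cong_below_def using subalg_disjoint[OF diff_subalg[of f D g], of below] D_iff
  by fastforce

lemma finite_I [simp]: "finite I"
  by (rule finite)

lemma G_subset_Rc: "G \<subseteq> Rc"
  by (auto simp: G_iff)

lemma G_subset_D: "G \<subseteq> D"
  using G_subset_Rc Rc_subset_D by blast

lemma B_mult: "b \<in> B \<Longrightarrow> c \<in> B \<Longrightarrow> b \<star> c \<in> B"
  by (rule mult_subalg) (auto intro: G_mult)

lemma B_subset_D: "b \<in> B \<Longrightarrow> b \<in> subalg D"
  using subalg_mono G_subset_D by blast

text \<open>The twisting identity for the triple \<open>e, e, y\<close> reads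
  \<open>\<alpha> e e * \<alpha> e y = \<alpha> e y * \<alpha> e y\<close>, and the nonzero scalar
  cancels. Constancy of these scalars makes a multiple of \<open>delta e\<close> act as an
  identity.\<close>

lemma alpha_e_left: "Rrel y e \<Longrightarrow> \<alpha> e y = \<alpha> e e"
proof -
  assume y: "Rrel y e"
  then have "\<alpha> e e * \<alpha> e y = \<alpha> e y * \<alpha> e y"
    using tw[unfolded twisting_def, rule_format, of e e y] by (simp add: ee Rrel_idempotent_iff[OF ee])
  then show ?thesis using nz[of e y] y by (simp add: Lrel_def)
qed

lemma alpha_e_right: "Lrel x e \<Longrightarrow> \<alpha> x e = \<alpha> e e"
proof -
  assume x: "Lrel x e"
  then have "\<alpha> x e * \<alpha> x e = \<alpha> x e * \<alpha> e e"
    using tw[unfolded twisting_def, rule_format, of x e e] by (simp add: ee Lrel_idempotent_iff[OF ee])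
  then show ?thesis using nz[of x e] x by (simp add: Rrel_def)
qed

text \<open>The basis vector of \<open>e\<close> squares to \<open>\<alpha> e e\<close> times
  itself, whence the normalisation.\<close>

definition unit_B :: "'a \<Rightarrow> 'r" where
  "unit_B = (\<lambda>z. 1 / \<alpha> e e * delta e z)"

lemma unit_B_in: "unit_B \<in> B"
  using e_in_G by (auto simp: unit_B_def subalg_def delta_def)

lemma unit_B_left:
  assumes "v \<in> subalg Rc"
  shows "unit_B \<star> v = v"
proof
  fix z
  have "(delta e \<star> v) z = (\<Sum>y\<in>UNIV. if y = z then v y * \<alpha> e e else 0)"
    unfolding delta_mult
  proof (intro sum.cong refl)
    show "(if e * y = z then v y * \<alpha> e y else 0) = (if y = z then v y * \<alpha> e e else 0)" for y
      using assms alpha_e_left[of y] Rrel_idempotent_iff[OF ee, of y]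
      by (cases "Rrel y e") (auto simp: subalg_def)
  qed
  then show "(unit_B \<star> v) z = v z"
    using nz[of e e] unfolding unit_B_def scale_left by (simp add: Lrel_def Rrel_def)
qed

lemma unit_B_right:
  assumes "v \<in> subalg {x. Lrel x e}"
  shows "v \<star> unit_B = v"
proof
  fix z
  have "(v \<star> delta e) z = (\<Sum>y\<in>UNIV. if y = z then v y * \<alpha> e e else 0)"
    unfolding mult_delta
  proof (intro sum.cong refl)
    show "(if y * e = z then v y * \<alpha> y e else 0) = (if y = z then v y * \<alpha> e e else 0)" for y
      using assms alpha_e_right[of y] Lrel_idempotent_iff[OF ee, of y]
      by (cases "Lrel y e") (auto simp: subalg_def)
  qed
  then show "(v \<star> unit_B) z = v z"
    using nz[of e e] unfolding unit_B_def scale_right by (simp add: Lrel_def Rrel_def)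
qed

lemma B_unit_B: "b \<in> B \<Longrightarrow> unit_B \<star> b = b" "b \<in> B \<Longrightarrow> b \<star> unit_B = b"
  by (rule unit_B_left, erule subalg_mono, simp add: G_iff subset_iff)
    (rule unit_B_right, erule subalg_mono, simp add: G_iff subset_iff)

lemma cong_B:
  assumes "f \<in> subalg (G \<union> below)"
  obtains b where "b \<in> B" "f \<approx> b"
proof
  show "(\<lambda>z. if z \<in> G then f z else 0) \<in> B" by (simp add: subalg_def)
  show "f \<approx> (\<lambda>z. if z \<in> G then f z else 0)"
    using assms by (auto simp: cong_below_def subalg_def)
qed

lemma Pm_B: "Pm L K \<in> B"
  by (auto simp: Pmat_def subalg_def)

text \<open>When the product of the representatives leaves \<open>G\<close> it falls strictly below
  \<open>D\<close>, exactly where the matrix entry is set to zero.\<close>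

lemma Pm_cong:
  assumes "L \<in> I" "K \<in> I"
  shows "delta (u L) \<star> delta (st (u K)) \<approx> Pm L K"
  using Rc_mult_Lc[OF u_R[OF assms(1)] st_u_L[OF assms(2)]]
  by (auto simp: cong_below_def delta_mult_delta Pmat_def subalg_def)

section \<open>Coordinates over the twisted group algebra\<close>

lemma Rc_coords_exist:
  assumes "v \<in> subalg Rc"
  shows "\<exists>c. (\<forall>L. c L \<in> B) \<and> v = (\<Sum>L\<in>I. c L \<star> delta (u L))"
proof -
  have "\<alpha> g (u L) \<noteq> 0" if "L \<in> I" "g \<in> G" for L g
    using that nz u_R by (auto simp: G_iff)
  then show ?thesis
  proof (rule right_coords_exist[OF bij_Rc finite_I _ assms])
    fix c assume "\<And>L. c L \<in> B" "v = (\<Sum>L\<in>I. c L \<star> delta (u L))"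
    then show ?thesis by (intro exI[of _ c]) simp
  qed
qed

lemma Rc_family_coords_exist:
  assumes "\<And>L. v L \<in> subalg Rc"
  shows "\<exists>c. \<forall>L. (\<forall>M. c L M \<in> B) \<and> v L = (\<Sum>M\<in>I. c L M \<star> delta (u M))"
  by (rule choice) (use Rc_coords_exist assms in blast)

lemma Rc_coords_unique:
  assumes "\<And>L. L \<in> I \<Longrightarrow> c L \<in> B" "\<And>L. L \<in> I \<Longrightarrow> d L \<in> B"
    and "(\<Sum>L\<in>I. c L \<star> delta (u L)) = (\<Sum>L\<in>I. d L \<star> delta (u L))" and "L \<in> I"
  shows "c L = d L"
  by (rule right_coords_unique[OF bij_betw_imp_inj_on[OF bij_Rc] finite_I _ assms])
    (use nz u_R in \<open>auto simp: G_iff\<close>)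

lemma D_coords_exist:
  assumes "f \<in> subalg D"
  shows "\<exists>v. (\<forall>L. v L \<in> subalg Rc) \<and> f = (\<Sum>L\<in>I. delta (st (u L)) \<star> v L)"
proof -
  have "\<alpha> (st (u L)) y \<noteq> 0" if "L \<in> I" "y \<in> Rc" for L y
    using that nz st_u_L by blast
  then show ?thesis
  proof (rule left_coords_exist[OF bij_D finite_I _ assms])
    fix v assume "\<And>L. v L \<in> subalg Rc" "f = (\<Sum>L\<in>I. delta (st (u L)) \<star> v L)"
    then show ?thesis by (intro exI[of _ v]) simp
  qed
qed

lemma D_coords_unique:
  assumes "\<And>L. L \<in> I \<Longrightarrow> c L \<in> subalg Rc" "\<And>L. L \<in> I \<Longrightarrow> d L \<in> subalg Rc"
    and "(\<Sum>L\<in>I. delta (st (u L)) \<star> c L) = (\<Sum>L\<in>I. delta (st (u L)) \<star> d L)" and "L \<in> I"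
  shows "c L = d L"
  by (rule left_coords_unique[OF bij_betw_imp_inj_on[OF bij_D] finite_I _ assms])
    (use nz st_u_L in auto)

lemma mat_mult_sum: "mat_mult \<alpha> A P Q i j = (\<Sum>k\<in>A. P i k \<star> Q k j)"
  by (rule ext) (simp add: mat_mult_def sum_fun_apply)

section \<open>Necessity: consequences of semiprimeness of the whole algebra\<close>

lemma left_ideal_subalg:
  assumes "\<And>s x. x \<in> X \<Longrightarrow> s * x \<in> X"
  shows "left_ideal (subalg X)"
  unfolding left_ideal_def using subspace_subalg
  by (auto intro!: mult_subalg[where X=UNIV and Y=X] assms) (auto simp: subalg_def)

lemma subalg_identity:
  assumes sp: "semiprime_on UNIV"
    and X: "\<And>s x. x \<in> X \<Longrightarrow> s * x \<in> X" "\<And>s x. x \<in> X \<Longrightarrow> x * s \<in> X"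
  obtains E where "E \<in> subalg X" "\<And>f. f \<in> subalg X \<Longrightarrow> f \<star> E = f" "\<And>f. f \<in> subalg X \<Longrightarrow> E \<star> f = f"
proof (rule two_sided_ideal_identity[OF sp left_ideal_subalg[of X]])
  show "f \<star> a \<in> subalg X" if "f \<in> subalg X" for a f
    by (rule mult_subalg[OF that, of a UNIV]) (auto simp: subalg_def X)
qed (use that X in auto)

text \<open>If \<open>E\<close> is the identity of the ideal spanned by the elements strictly below \<open>D\<close>, then \<open>E\<close>
  is central, and \<open>f = b - E b\<close> satisfies \<open>f a f = b a b - E b a b = 0\<close> as \<open>b a b\<close> lies below \<open>D\<close>.\<close>

lemma semiprime_group_algebra:
  assumes sp: "semiprime_on UNIV"
  shows "semiprime_on B"
  unfolding semiprime_on_def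
proof (intro ballI impI)
  fix b assume b: "b \<in> B" and bBb: "\<forall>a\<in>B. b \<star> (a \<star> b) = 0"
  obtain E where E: "E \<in> subalg below" "\<And>f. f \<in> subalg below \<Longrightarrow> f \<star> E = f"
      "\<And>f. f \<in> subalg below \<Longrightarrow> E \<star> f = f"
    using subalg_identity[OF sp, of below] below_mult by blast
  \<comment> \<open>Both \<open>E \<star> a\<close> and \<open>a \<star> E\<close> lie in the ideal,
    so each equals \<open>E \<star> a \<star> E\<close>.\<close>
  have central: "E \<star> a = a \<star> E" for a
    using E(2)[OF below_ideal(2)[OF E(1), of a]] E(3)[OF below_ideal(1)[OF E(1), of a]]
    by (simp add: assoc)
  \<comment> \<open>As \<open>unit_B\<close> fixes \<open>b\<close> on both sides, \<open>a\<close>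
    may be replaced by its corner part, which is congruent to an element of \<open>B\<close>; for
    the latter the product is zero by assumption.\<close>
  have bab: "b \<star> (a \<star> b) \<in> subalg below" for a
  proof -
    have corner: "e * (s * e) \<in> G \<union> below" for s
      using corner_cases[of "e * (s * e)"] by (simp add: mult.assoc ee) (simp add: mult.assoc[symmetric] ee)
    have ids: "unit_B \<in> subalg {e}" by (auto simp: unit_B_def subalg_def delta_def)
    have "a \<star> unit_B \<in> subalg (range (\<lambda>s. s * e))"
    proof (rule mult_subalg[OF _ ids])
      show "a \<in> subalg UNIV" by (simp add: subalg_def)
    qed simp
    then have "unit_B \<star> (a \<star> unit_B) \<in> subalg (G \<union> below)"
    proof (rule mult_subalg[OF ids])
      show "x * y \<in> G \<union> below" if "x \<in> {e}" "y \<in> range (\<lambda>s. s * e)" for x y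
        using that corner by blast
    qed
    then obtain a' where a': "a' \<in> B" "unit_B \<star> (a \<star> unit_B) \<approx> a'" by (rule cong_B)
    have "b \<star> (a \<star> b) = (b \<star> unit_B) \<star> (a \<star> (unit_B \<star> b))" using B_unit_B b by simp
    also have "\<dots> = b \<star> ((unit_B \<star> (a \<star> unit_B)) \<star> b)" by (simp only: assoc)
    also have "\<dots> \<approx> b \<star> (a' \<star> b)" by (rule cong_mult_left[OF cong_mult_right[OF a'(2)]])
    also have "\<dots> = 0" using bBb a'(1) by blast
    finally show ?thesis by (simp only: cong_below_def diff_0_right)
  qed
  define f where "f = b - E \<star> b"
  have "f \<star> (a \<star> f) = 0" for a
  proof -
    have "E \<star> (b \<star> (a \<star> b)) = b \<star> (a \<star> b)" using E(3) bab by blast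
    moreover have comm: "x \<star> (E \<star> y) = E \<star> (x \<star> y)" for x y
      by (simp only: assoc[symmetric] central[of x])
    then have "b \<star> (a \<star> (E \<star> b)) = E \<star> (b \<star> (a \<star> b))" by (simp only:)
    ultimately show ?thesis
      by (simp add: f_def diff_left diff_right assoc)
  qed
  then have "f = 0" using sp unfolding semiprime_on_def by blast
  then have "b = E \<star> b" by (simp add: f_def)
  then have "b \<in> subalg below" using below_ideal(2)[OF E(1)] by metis
  then show "b = 0" using b B_subset_D D_iff subalg_disjoint[of b D below] by fastforce
qed

lemma delta_u_unit_B: "L \<in> I \<Longrightarrow> unit_B \<star> delta (u L) = delta (u L)"
  by (rule unit_B_left) (simp add: delta_subalg u_R)

lemma delta_st_u_unit_B: "L \<in> I \<Longrightarrow> delta (st (u L)) \<star> unit_B = delta (st (u L))"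
  by (rule unit_B_right) (simp add: delta_subalg st_u_L)

lemma B_subset_Rc: "b \<in> B \<Longrightarrow> b \<in> subalg Rc"
  using subalg_mono G_subset_Rc by blast

text \<open>The coordinates of the identity of \<open>R\<^sup>\<alpha>[D]\<close> modulo lower classes form the inverse of the
  sandwich matrix.\<close>

lemma sandwich_invertible:
  assumes sp: "semiprime_on UNIV"
  shows "mat_invertible \<alpha> B I Pm"
proof -
  let ?J = "{x. leJ x e}"
  have J: "s * x \<in> ?J" "x * s \<in> ?J" if "x \<in> ?J" for s x
    using that leJ_trans[OF leL_imp_leJ[OF leL_mult]] leJ_trans[OF leR_imp_leJ[OF leR_mult]] by auto
  obtain E where E: "E \<in> subalg ?J" "\<And>f. f \<in> subalg ?J \<Longrightarrow> f \<star> E = f"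
      "\<And>f. f \<in> subalg ?J \<Longrightarrow> E \<star> f = f"
    using subalg_identity[OF sp, of ?J] J by blast
  \<comment> \<open>The part of \<open>E\<close> on \<open>D\<close> has a coordinate matrix, named
    \<open>Q\<close> below.\<close>
  define F where "F = (\<lambda>z. if z \<in> D then E z else 0)"
  have EF: "E \<approx> F" using E(1) by (auto simp: cong_below_def subalg_def F_def D_iff)
  have "F \<in> subalg D" by (simp add: F_def subalg_def)
  from D_coords_exist[OF this] obtain v
    where "(\<forall>L. v L \<in> subalg Rc) \<and> F = (\<Sum>L\<in>I. delta (st (u L)) \<star> v L)" ..
  then have v: "v L \<in> subalg Rc" "F = (\<Sum>L\<in>I. delta (st (u L)) \<star> v L)" for L by simp_all
  from Rc_family_coords_exist[of v, OF v(1)] obtain Q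
    where "\<forall>L. (\<forall>M. Q L M \<in> B) \<and> v L = (\<Sum>M\<in>I. Q L M \<star> delta (u M))" ..
  then have Q: "Q L M \<in> B" "v L = (\<Sum>M\<in>I. Q L M \<star> delta (u M))" for L M by simp_all
  have one_or_zero: "(if i = j then unit_B else 0) \<in> B" for i j :: "'a set" using unit_B_in by simp
  \<comment> \<open>Expand \<open>E \<star> delta (st (u M)) = delta (st (u M))\<close> modulo lower
    classes and compare left coordinates.\<close>
  have QP: "(\<Sum>N\<in>I. Q K N \<star> Pm N M) = (if K = M then unit_B else 0)" if K: "K \<in> I" and M: "M \<in> I" for K M
  proof -
    let ?d = "\<lambda>K. if K = M then unit_B else 0"
    have J: "delta (st (u M)) \<in> subalg ?J"
      using st_u_L[OF M] by (simp add: delta_subalg Lrel_def leL_imp_leJ)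
    have "delta (st (u M)) = E \<star> delta (st (u M))" by (rule E(3)[OF J, symmetric])
    also have "\<dots> \<approx> F \<star> delta (st (u M))" by (rule cong_mult_right[OF EF])
    also have "\<dots> = (\<Sum>K\<in>I. delta (st (u K)) \<star> (\<Sum>N\<in>I. Q K N \<star> (delta (u N) \<star> delta (st (u M)))))"
      by (simp add: v(2) Q(2) sum_left assoc)
    also have "\<dots> \<approx> (\<Sum>K\<in>I. delta (st (u K)) \<star> (\<Sum>N\<in>I. Q K N \<star> Pm N M))"
      by (intro cong_sum cong_mult_left Pm_cong M)
    finally have c: "delta (st (u M)) \<approx> (\<Sum>K\<in>I. delta (st (u K)) \<star> (\<Sum>N\<in>I. Q K N \<star> Pm N M))" .
    have QPB: "(\<Sum>N\<in>I. Q K N \<star> Pm N M) \<in> B" for K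
      by (intro sum_subalg B_mult Q Pm_B)
    have "delta (st (u K)) \<star> (\<Sum>N\<in>I. Q K N \<star> Pm N M) \<in> subalg D" if "K \<in> I" for K
      by (rule mult_subalg[of _ "{st (u K)}" _ Rc, OF _ B_subset_Rc[OF QPB]])
        (use bij_betw_apply[OF bij_D] that in \<open>auto simp: delta_subalg\<close>)
    then have "(\<Sum>K\<in>I. delta (st (u K)) \<star> (\<Sum>N\<in>I. Q K N \<star> Pm N M)) \<in> subalg D"
      by (rule sum_subalg)
    moreover have "delta (st (u M)) \<in> subalg D"
      using st_u_L[OF M] by (simp add: delta_subalg Lc_subset_D)
    ultimately have "delta (st (u M)) = (\<Sum>K\<in>I. delta (st (u K)) \<star> (\<Sum>N\<in>I. Q K N \<star> Pm N M))"
      using c by (intro cong_eq)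
    moreover have "(\<Sum>K\<in>I. delta (st (u K)) \<star> ?d K) = (\<Sum>K\<in>I. if K = M then delta (st (u M)) else 0)"
      by (intro sum.cong refl) (auto simp: delta_st_u_unit_B[OF M])
    then have "(\<Sum>K\<in>I. delta (st (u K)) \<star> ?d K) = delta (st (u M))" using M by simp
    ultimately show ?thesis
      using D_coords_unique[of "\<lambda>K. \<Sum>N\<in>I. Q K N \<star> Pm N M" ?d K] K QPB one_or_zero B_subset_Rc by simp
  qed
  \<comment> \<open>Likewise \<open>E\<close> fixes \<open>delta (u L)\<close> from the right, and
    right coordinates are compared.\<close>
  have PQ: "(\<Sum>K\<in>I. Pm L K \<star> Q K M) = (if L = M then unit_B else 0)" if L: "L \<in> I" and M: "M \<in> I" for L M
  proof -
    let ?d = "\<lambda>M. if L = M then unit_B else 0"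
    have J: "delta (u L) \<in> subalg ?J"
      using u_R[OF L] by (simp add: delta_subalg Rrel_def leR_imp_leJ)
    have "delta (u L) = delta (u L) \<star> E" by (rule E(2)[OF J, symmetric])
    also have "\<dots> \<approx> delta (u L) \<star> F" by (rule cong_mult_left[OF EF])
    also have "\<dots> = (\<Sum>K\<in>I. (delta (u L) \<star> delta (st (u K))) \<star> v K)"
      by (simp add: v(2) sum_right assoc)
    also have "\<dots> \<approx> (\<Sum>K\<in>I. Pm L K \<star> v K)"
      by (intro cong_sum cong_mult_right Pm_cong L)
    also have "\<dots> = (\<Sum>M\<in>I. (\<Sum>K\<in>I. Pm L K \<star> Q K M) \<star> delta (u M))"
      unfolding Q(2) sum_left sum_right by (subst sum.swap) (simp add: assoc)
    finally have c: "delta (u L) \<approx> (\<Sum>M\<in>I. (\<Sum>K\<in>I. Pm L K \<star> Q K M) \<star> delta (u M))" .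
    have PQB: "(\<Sum>K\<in>I. Pm L K \<star> Q K M) \<in> B" for M
      by (intro sum_subalg B_mult Q Pm_B)
    have "(\<Sum>K\<in>I. Pm L K \<star> Q K M) \<star> delta (u M) \<in> subalg D" if "M \<in> I" for M
      by (rule mult_subalg[OF PQB, of _ "{u M}"])
        (use G_mult_Rc u_R[OF that] Rc_subset_D in \<open>auto simp: delta_subalg\<close>)
    then have "(\<Sum>M\<in>I. (\<Sum>K\<in>I. Pm L K \<star> Q K M) \<star> delta (u M)) \<in> subalg D"
      by (rule sum_subalg)
    moreover have "delta (u L) \<in> subalg D"
      using u_R[OF L] Rc_subset_D by (auto simp: delta_subalg)
    ultimately have "delta (u L) = (\<Sum>M\<in>I. (\<Sum>K\<in>I. Pm L K \<star> Q K M) \<star> delta (u M))"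
      using c by (intro cong_eq)
    moreover have "(\<Sum>M\<in>I. ?d M \<star> delta (u M)) = (\<Sum>M\<in>I. if L = M then delta (u L) else 0)"
      by (intro sum.cong refl) (auto simp: delta_u_unit_B[OF L])
    then have "(\<Sum>M\<in>I. ?d M \<star> delta (u M)) = delta (u L)" using L by simp
    ultimately show ?thesis
      using Rc_coords_unique[of "\<lambda>M. \<Sum>K\<in>I. Pm L K \<star> Q K M" ?d M] M PQB one_or_zero by simp
  qed
  show ?thesis
    unfolding mat_invertible_def mat_mult_sum zero_fun_def[symmetric]
    using unit_B_in B_unit_B Q(1) PQ QP by (intro bexI[of _ unit_B] conjI exI[of _ Q]) auto
qed

text \<open>If \<open>f\<close> has no support strictly above \<open>D\<close>, the corner elements \<open>u\<^sub>L f u\<^sub>N\<^sup>*\<close> are congruent to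
  the entries of \<open>P c P\<close>, where \<open>c\<close> is the coordinate matrix of \<open>f\<close> on \<open>D\<close>.\<close>

lemma vanish_on_D:
  assumes sp: "semiprime_on B" and invP: "mat_invertible \<alpha> B I Pm"
    and fAf: "\<And>a. f \<star> (a \<star> f) = 0"
    and top: "\<And>y. f y \<noteq> 0 \<Longrightarrow> leJ e y \<Longrightarrow> leJ y e"
    and y: "y \<in> D"
  shows "f y = 0"
proof -
  from invP[unfolded mat_invertible_def mat_mult_sum zero_fun_def[symmetric]]
  obtain one where "one \<in> B" and one_Q: "(\<forall>b\<in>B. one \<star> b = b \<and> b \<star> one = b)
      \<and> (\<exists>Q. (\<forall>i\<in>I. \<forall>j\<in>I. Q i j \<in> B)
        \<and> (\<forall>i\<in>I. \<forall>j\<in>I. (\<Sum>k\<in>I. Pm i k \<star> Q k j) = (if i = j then one else 0))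
        \<and> (\<forall>i\<in>I. \<forall>j\<in>I. (\<Sum>k\<in>I. Q i k \<star> Pm k j) = (if i = j then one else 0)))" ..
  then have one: "one \<star> b = b" "b \<star> one = b" if "b \<in> B" for b using that by simp_all
  from one_Q[THEN conjunct2] obtain Q where Q: "(\<forall>i\<in>I. \<forall>j\<in>I. Q i j \<in> B)
      \<and> (\<forall>i\<in>I. \<forall>j\<in>I. (\<Sum>k\<in>I. Pm i k \<star> Q k j) = (if i = j then one else 0))
      \<and> (\<forall>i\<in>I. \<forall>j\<in>I. (\<Sum>k\<in>I. Q i k \<star> Pm k j) = (if i = j then one else 0))" ..
  have PQ: "(\<Sum>k\<in>I. Pm i k \<star> Q k j) = (if i = j then one else 0)"
    and QP: "(\<Sum>k\<in>I. Q i k \<star> Pm k j) = (if i = j then one else 0)" if "i \<in> I" "j \<in> I" for i j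
    using Q that by simp_all
  define F where "F = (\<lambda>z. if z \<in> D then f z else 0)"
  have "F \<in> subalg D" by (simp add: F_def subalg_def)
  from D_coords_exist[OF this] obtain v
    where "(\<forall>L. v L \<in> subalg Rc) \<and> F = (\<Sum>L\<in>I. delta (st (u L)) \<star> v L)" ..
  then have v: "v L \<in> subalg Rc" "F = (\<Sum>L\<in>I. delta (st (u L)) \<star> v L)" for L by simp_all
  from Rc_family_coords_exist[of v, OF v(1)] obtain c
    where "\<forall>L. (\<forall>M. c L M \<in> B) \<and> v L = (\<Sum>M\<in>I. c L M \<star> delta (u M))" ..
  then have c: "c L M \<in> B" "v L = (\<Sum>M\<in>I. c L M \<star> delta (u M))" for L M by simp_all
  \<comment> \<open>With \<open>c\<close> the coordinate matrix of the part of \<open>f\<close> on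
    \<open>D\<close>, this is the matrix product of \<open>c\<close> and \<open>Pm\<close>.\<close>
  define W where "W K N = (\<Sum>M\<in>I. c K M \<star> Pm M N)" for K N
  have W: "W K N \<in> B" for K N unfolding W_def by (intro sum_subalg B_mult c Pm_B)
  have PW: "(\<Sum>K\<in>I. Pm L K \<star> W K N) = 0" if L: "L \<in> I" and N: "N \<in> I" for L N
  proof -
    let ?l = "delta (u L)" and ?r = "delta (st (u N))" and ?Y = "\<Sum>K\<in>I. Pm L K \<star> W K N"
    have Y: "?Y \<in> B" by (intro sum_subalg B_mult W Pm_B)
    \<comment> \<open>A support element \<open>z\<close> outside \<open>D\<close> may be
      incomparable with \<open>e\<close>, but by \<open>top\<close> it is not above
      \<open>e\<close>. Hence \<open>u L * z\<close> is below \<open>e\<close> and not above it, so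
      it vanishes modulo lower classes.\<close>
    have "?l \<star> (f - F) \<in> subalg below"
    proof (rule mult_subalg[of _ "{u L}" _ "{x. f x \<noteq> 0 \<and> x \<notin> D}"])
      show "x * z \<in> below" if "x \<in> {u L}" "z \<in> {x. f x \<noteq> 0 \<and> x \<notin> D}" for x z
      proof -
        have "leJ (x * z) e"
          using that u_R[OF L] leJ_trans[OF leR_imp_leJ[OF leR_mult[of "u L" z]] leR_imp_leJ[of "u L" e]]
          by (simp add: Rrel_def)
        moreover have "\<not> leJ e z" using that top by (auto simp: D_iff)
        then have "\<not> leJ e (x * z)" using leJ_trans[OF _ leL_imp_leJ[OF leL_mult]] by blast
        ultimately show ?thesis by simp
      qed
    qed (auto simp: delta_subalg, simp add: subalg_def F_def)
    then have "?l \<star> f \<approx> ?l \<star> F" by (simp add: cong_below_def diff_right)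
    then have "?l \<star> f \<star> ?r \<approx> ?l \<star> F \<star> ?r" by (rule cong_mult_right)
    also have "\<dots> = (\<Sum>K\<in>I. (?l \<star> delta (st (u K))) \<star> (\<Sum>M\<in>I. c K M \<star> (delta (u M) \<star> ?r)))"
      by (simp add: v(2) c(2) sum_left sum_right assoc)
    also have "\<dots> \<approx> (\<Sum>K\<in>I. (?l \<star> delta (st (u K))) \<star> W K N)"
      unfolding W_def by (intro cong_sum cong_mult_left Pm_cong N)
    also have "\<dots> \<approx> ?Y" by (intro cong_sum cong_mult_right Pm_cong L)
    finally have X: "?l \<star> f \<star> ?r \<approx> ?Y" .
    \<comment> \<open>Replacing both copies of \<open>?Y\<close> by the congruent corner elements
      exposes a factor of the form \<open>f \<star> (a' \<star> f)\<close>.\<close>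
    have "?Y \<star> (a \<star> ?Y) = 0" if a: "a \<in> B" for a
    proof (rule cong_eq)
      have "?Y \<star> (a \<star> ?Y) \<approx> (?l \<star> f \<star> ?r) \<star> (a \<star> ?Y)"
        by (rule cong_mult_right[OF cong_sym[OF X]])
      also have "\<dots> \<approx> (?l \<star> f \<star> ?r) \<star> (a \<star> (?l \<star> f \<star> ?r))"
        by (intro cong_mult_left cong_sym[OF X])
      also have "\<dots> = ?l \<star> ((f \<star> ((?r \<star> (a \<star> ?l)) \<star> f)) \<star> ?r)" by (simp only: assoc)
      also have "\<dots> = 0" unfolding fAf by simp
      finally show "?Y \<star> (a \<star> ?Y) \<approx> 0" .
      show "?Y \<star> (a \<star> ?Y) \<in> subalg D" using Y a by (intro B_subset_D B_mult)
    qed simp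
    then show ?thesis using sp Y unfolding semiprime_on_def by blast
  qed
  \<comment> \<open>Invertibility cancels the left copy of \<open>Pm\<close>, and then the right
    copy in \<open>c0\<close>.\<close>
  have W0: "W H N = 0" if H: "H \<in> I" and N: "N \<in> I" for H N
  proof -
    have "0 = (\<Sum>L\<in>I. Q H L \<star> (\<Sum>K\<in>I. Pm L K \<star> W K N))" using PW N by simp
    also have "\<dots> = (\<Sum>K\<in>I. (\<Sum>L\<in>I. Q H L \<star> Pm L K) \<star> W K N)"
      unfolding sum_left sum_right by (subst sum.swap) (simp add: assoc)
    also have "\<dots> = (\<Sum>K\<in>I. if H = K then W H N else 0)"
      using QP[OF H] one(1) W by (intro sum.cong refl) auto
    also have "\<dots> = W H N" using H by simp
    finally show ?thesis by simp
  qed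
  have c0: "c K H = 0" if K: "K \<in> I" and H: "H \<in> I" for K H
  proof -
    have "0 = (\<Sum>N\<in>I. W K N \<star> Q N H)" using W0 K by simp
    also have "\<dots> = (\<Sum>M\<in>I. c K M \<star> (\<Sum>N\<in>I. Pm M N \<star> Q N H))"
      unfolding W_def sum_left sum_right by (subst sum.swap) (simp add: assoc)
    also have "\<dots> = (\<Sum>M\<in>I. if M = H then c K H else 0)"
      using PQ[OF _ H] one(2) c(1) by (intro sum.cong refl) auto
    also have "\<dots> = c K H" using H by simp
    finally show ?thesis by simp
  qed
  have "v L = 0" if "L \<in> I" for L using c0[OF that] by (simp add: c(2))
  then have "F = 0" by (simp add: v(2))
  then show ?thesis using y by (auto simp: F_def fun_eq_iff split: if_splits)
qed

end

text \<open>The number of elements below \<open>x\<close> grows along the preorder, and equality of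
  these numbers forces equality of the lower sets. A support element with the largest number is
  therefore maximal.\<close>

lemma support_has_leJ_maximal:
  fixes f :: "'a::{finite,semigroup_mult} \<Rightarrow> 'r::zero"
  assumes "f z \<noteq> 0"
  obtains x where "f x \<noteq> 0" "\<And>y. f y \<noteq> 0 \<Longrightarrow> leJ x y \<Longrightarrow> leJ y x"
proof -
  let ?c = "\<lambda>x. card {y. leJ y x}"
  have "\<forall>y. f y \<noteq> 0 \<longrightarrow> ?c y < Suc (card (UNIV :: 'a set))"
    by (simp add: card_mono less_Suc_eq_le)
  with assms have "\<exists>x. f x \<noteq> 0 \<and> (\<forall>y. f y \<noteq> 0 \<longrightarrow> ?c y \<le> ?c x)"
    by (rule ex_has_greatest_nat)
  then obtain x where x: "f x \<noteq> 0" "\<And>y. f y \<noteq> 0 \<Longrightarrow> ?c y \<le> ?c x" by blast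
  have "leJ y x" if y: "f y \<noteq> 0" "leJ x y" for y
  proof -
    have "{w. leJ w x} \<subseteq> {w. leJ w y}" using leJ_trans y(2) by blast
    then have "{w. leJ w x} = {w. leJ w y}" using x(2)[OF y(1)] by (intro card_seteq) auto
    then show ?thesis using leJ_refl by blast
  qed
  with x(1) that show thesis by blast
qed

theorem theorem16:
  fixes st :: "'a::{finite,semigroup_mult} \<Rightarrow> 'a"
    and \<alpha> :: "'a \<Rightarrow> 'a \<Rightarrow> 'r::field"
    and one :: "'a set \<Rightarrow> 'a"
    and u :: "'a set \<Rightarrow> 'a"
  assumes inv: "anti_involution st"
    and tw: "twisting \<alpha>"
    and tw_sym: "\<forall>x y. \<alpha> x y = \<alpha> (st y) (st x)"
    and idem: "\<forall>D\<in>Dclasses. one D \<in> D \<and> one D * one D = one D \<and> st (one D) = one D"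
    and nonzero: "\<forall>D\<in>Dclasses. \<forall>x y. Lrel x (one D) \<and> Rrel y (one D) \<longrightarrow> \<alpha> x y \<noteq> 0"
    and cell: "\<forall>D\<in>Dclasses. cellular \<alpha> st (Hclass (one D))"
    and reps: "\<forall>D\<in>Dclasses. \<forall>L\<in>Lclasses_in D. u L \<in> L \<and> Rrel (u L) (one D)"
  shows "semisimple \<alpha> UNIV \<longleftrightarrow>
    (\<forall>D\<in>Dclasses. semisimple \<alpha> (subalg (Hclass (one D)))
       \<and> mat_invertible \<alpha> (subalg (Hclass (one D))) (Lclasses_in D) (Pmat \<alpha> st u (Hclass (one D))))"
proof -
  interpret twisted_algebra \<alpha> by unfold_locales (rule tw)
  \<comment> \<open>The locales describe a class as that of its idempotent; this identifies it with
    the given \<open>D\<close>.\<close>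
  have D_eq: "Dclass (one D) = D" if D: "D \<in> Dclasses" for D
  proof -
    obtain x where "D = Dclass x" using D unfolding Dclasses_def by blast
    moreover from this have "Drel x (one D)" using idem D by (auto simp: Dclass_def)
    ultimately show ?thesis using Dclass_eq by metis
  qed
  have loc: "twisted_Dclass \<alpha> st (one D) u" if D: "D \<in> Dclasses" for D
    using inv tw idem nonzero reps D by unfold_locales (simp_all add: D_eq)
  have semi_iff: "semisimple \<alpha> (subalg (Hclass (one D))) \<longleftrightarrow> semiprime_on (subalg (Hclass (one D)))"
    if D: "D \<in> Dclasses" for D
    using semiprime_on_if_semisimple[OF subspace_subalg twisted_Dclass.B_mult[OF loc[OF D]]]
      semisimple_if_semiprime_on by blast
  show ?thesis
  proof
    assume "semisimple \<alpha> UNIV"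
    then have sp: "semiprime_on UNIV"
      by (rule semiprime_on_if_semisimple[rotated 2]) auto
    show "\<forall>D\<in>Dclasses. semisimple \<alpha> (subalg (Hclass (one D)))
       \<and> mat_invertible \<alpha> (subalg (Hclass (one D))) (Lclasses_in D) (Pmat \<alpha> st u (Hclass (one D)))"
    proof (intro ballI conjI)
      fix D :: "'a set" assume D: "D \<in> Dclasses"
      show "semisimple \<alpha> (subalg (Hclass (one D)))"
        unfolding semi_iff[OF D] by (rule twisted_Dclass.semiprime_group_algebra[OF loc[OF D] sp])
      show "mat_invertible \<alpha> (subalg (Hclass (one D))) (Lclasses_in D) (Pmat \<alpha> st u (Hclass (one D)))"
        using twisted_Dclass.sandwich_invertible[OF loc[OF D] sp] by (simp add: D_eq[OF D])
    qed
  next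
    assume R: "\<forall>D\<in>Dclasses. semisimple \<alpha> (subalg (Hclass (one D)))
       \<and> mat_invertible \<alpha> (subalg (Hclass (one D))) (Lclasses_in D) (Pmat \<alpha> st u (Hclass (one D)))"
    have "f = 0" if fAf: "\<forall>a\<in>UNIV. f \<star> (a \<star> f) = 0" for f
    proof (rule ccontr)
      assume "f \<noteq> 0"
      then obtain z where "f z \<noteq> 0" by (auto simp: fun_eq_iff)
      \<comment> \<open>Maximality of \<open>x\<close> transfers to the idempotent of its class and
        supplies the hypothesis \<open>top\<close>; the vanishing of \<open>f\<close> on that class
        then contradicts the choice of \<open>x\<close>.\<close>
      then obtain x where x: "f x \<noteq> 0" "\<And>y. f y \<noteq> 0 \<Longrightarrow> leJ x y \<Longrightarrow> leJ y x"
        by (rule support_has_leJ_maximal) blast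
      define D where "D = Dclass x"
      have D: "D \<in> Dclasses" by (auto simp: D_def Dclasses_def)
      interpret twisted_Dclass \<alpha> st "one D" u by (rule loc[OF D])
      have xe: "leJ x (one D)" "leJ (one D) x"
        using idem D unfolding D_def Dclass_def by (auto simp: Drel_iff_leJ)
      have "f x = 0"
      proof (rule vanish_on_D)
        show "semiprime_on B" using R D semi_iff by blast
        show "mat_invertible \<alpha> B I Pm" using R D by (simp add: D_eq)
        show "f \<star> (a \<star> f) = 0" for a using fAf by blast
        show "leJ y (one D)" if "f y \<noteq> 0" "leJ (one D) y" for y
          using x(2)[OF that(1)] that(2) xe leJ_trans by blast
        show "x \<in> Dclass (one D)" using xe by (simp add: D_iff)
      qed
      then show False using x(1) by simp
    qed
    then have "semiprime_on UNIV" unfolding semiprime_on_def by blast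
    then show "semisimple \<alpha> UNIV" by (rule semisimple_if_semiprime_on)
  qed
qed

end
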